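(* Let $\gamma\ge1$ be an integer and let $C\subset\mathbb{Z}/p^\gamma\mathbb{Z}$ be nonempty. The following are equivalent: (1) $C$ is $p$-homogeneous; (2) for every $1\le i\le\gamma$, $\sharp(C \bmod p^i)=p^{k_i}$ for some integer $k_i\ge0$; (3) there is a set $I\subset\mathbb{N}$ with $\sharp I=\log_p(\sharp C)$ and $\widehat{1_C}(p^\ell)=0$ for all $\ell\in I$; (4) there is a set $I\subset\mathbb{N}$ with $\sharp I\ge\log_p(\sharp C)$ and $\widehat{1_C}(p^\ell)=0$ for all $\ell\in I$; (5) $C$ tiles $\mathbb{Z}/p^\gamma\mathbb{Z}$; (6) $C$ is a spectral set in $\mathbb{Z}/p^\gamma\mathbb{Z}$.
   Context: $p\ge2$ is a prime and $\mathbb{N}=\{0,1,2,\dots\}$. $\mathbb{Z}/p^\gamma\mathbb{Z}$ is identified with $\{0,1,\dots,p^\gamma-1\}$. Reductions: for $0\le n\le\gamma$, $C \bmod p^n=\{x\in\{0,\dots,p^n-1\}:\exists y\in C,\ x\equiv y \pmod{p^n}\}$. $p$-homogeneity: $C$ is $p$-homogeneous if for every $n\in\{0,1,\dots,\gamma-1\}$, either every $x\in C \bmod p^n$ has exactly one $y\in C \bmod p^{n+1}$ with $y\equiv x \pmod{p^n}$, or every such $x$ has exactly $p$ such $y$. Fourier transform on $\mathbb{Z}/p^\gamma\mathbb{Z}$: $\widehat f(k)=\sum_{x\in\mathbb{Z}/p^\gamma\mathbb{Z}}f(x)e^{-2\pi ikx/p^\gamma}$. Tiling: $C$ tiles $\mathbb{Z}/p^\gamma\mathbb{Z}$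 if there is $S\subset\mathbb{Z}/p^\gamma\mathbb{Z}$ such that every element of $\mathbb{Z}/p^\gamma\mathbb{Z}$ is uniquely written as $c+s$ with $c\in C$ and $s\in S$. Spectral set: $C$ is spectral if there is $\Lambda\subset\mathbb{Z}/p^\gamma\mathbb{Z}$ such that the functions $x\mapsto e^{2\pi ikx/p^\gamma}$, for $k\in\Lambda$, restricted to $C$, form an orthogonal basis of the space of complex functions on $C$. *)

theory Defs
  imports Complex_Main "HOL-Computational_Algebra.Primes"
begin

text \<open>Z/p^gamma Z is identified with {0..<p^gamma}; subsets are nat sets contained in it.\<close>

definition red :: "nat set \<Rightarrow> nat \<Rightarrow> nat set" where
  "red C m = (\<lambda>y. y mod m) ` C"

definition p_homogeneous :: "nat \<Rightarrow> nat \<Rightarrow> nat set \<Rightarrow> bool" where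
  "p_homogeneous p \<gamma> C \<longleftrightarrow>
     (\<forall>n<\<gamma>.
        (\<forall>x\<in>red C (p^n). card {y \<in> red C (p^(n+1)). y mod p^n = x} = 1)
      \<or> (\<forall>x\<in>red C (p^n). card {y \<in> red C (p^(n+1)). y mod p^n = x} = p))"

definition fourier :: "nat \<Rightarrow> nat \<Rightarrow> (nat \<Rightarrow> complex) \<Rightarrow> nat \<Rightarrow> complex" where
  "fourier p \<gamma> f k = (\<Sum>x<p^\<gamma>. f x * cis (- 2 * pi * real k * real x / real (p^\<gamma>)))"

definition tiles :: "nat \<Rightarrow> nat \<Rightarrow> nat set \<Rightarrow> bool" where
  "tiles p \<gamma> C \<longleftrightarrow> (\<exists>S. S \<subseteq> {..<p^\<gamma>} \<and>
     (\<forall>z<p^\<gamma>. \<exists>!cs. fst cs \<in> C \<and> snd cs \<in> S \<and> (fst cs + snd cs) mod p^\<gamma> = z))"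

definition expo :: "nat \<Rightarrow> nat \<Rightarrow> nat \<Rightarrow> nat \<Rightarrow> complex" where
  "expo p \<gamma> k x = cis (2 * pi * real k * real x / real (p^\<gamma>))"

definition spectral :: "nat \<Rightarrow> nat \<Rightarrow> nat set \<Rightarrow> bool" where
  "spectral p \<gamma> C \<longleftrightarrow> (\<exists>\<Lambda>. \<Lambda> \<subseteq> {..<p^\<gamma>} \<and>
     (\<forall>k\<in>\<Lambda>. \<forall>k'\<in>\<Lambda>. k \<noteq> k' \<longrightarrow>
        (\<Sum>x\<in>C. expo p \<gamma> k x * cnj (expo p \<gamma> k' x)) = 0) \<and>
     (\<forall>f :: nat \<Rightarrow> complex. \<exists>a :: nat \<Rightarrow> complex.
        \<forall>x\<in>C. f x = (\<Sum>k\<in>\<Lambda>. a k * expo p \<gamma> k x)))"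

end

theory Submission
  imports Defs "HOL-Computational_Algebra.Polynomial"
begin

text \<open>
  View the reductions of \<open>C\<close> modulo \<open>p ^ n\<close> as the levels of a \<open>p\<close>-ary tree. Since the cyclotomic
  polynomial of order \<open>p ^ (n + 1)\<close> is irreducible, a sum of powers \<open>z ^ x\<close> over \<open>x \<in> C\<close>, with \<open>z\<close> a
  primitive root of unity of that order, vanishes iff the points of \<open>C\<close> above each vertex of level
  \<open>n\<close> are distributed equally among its \<open>p\<close> possible children. If this happens at \<open>e\<close> levels and the
  tree branches at \<open>b\<close> levels, then \<open>p ^ e \<le> card C \<le> p ^ b\<close> and \<open>e \<le> b\<close>; homogeneity means that
  every branching level is equidistributed, equivalently \<open>card C \<le> p ^ e\<close>.

  For a tiling by \<open>C\<close> and \<open>S\<close> the product of the two transforms vanishes at every \<open>p ^ l\<close>, so every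
  level is equidistributed for \<open>C\<close> or for \<open>S\<close>; counting forces \<open>card C \<le> p ^ e\<close>. For a spectrum \<open>L\<close>,
  expanding a point mass gives \<open>card L = card C\<close>, while each branching level \<open>l\<close> of \<open>L\<close> makes level
  \<open>\<gamma> - 1 - l\<close> of \<open>C\<close> equidistributed. Conversely, numbers whose base-\<open>p\<close> digits are free exactly at
  prescribed positions provide the complement and the spectrum of a homogeneous set.
\<close>

subsection \<open>Vanishing sums of roots of unity of prime power order\<close>

text \<open>If both factors had positive degree, exactly one of their constant terms would be
  divisible by \<open>p\<close>. The first coefficient of that factor not divisible by
  \<open>p\<close> then produces a coefficient of \<open>F\<close> below its degree that is not
  divisible by \<open>p\<close>.\<close>

lemma eisenstein_factor_degree:
  fixes F g h :: "int poly" and p :: int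
  assumes p: "prime p" and F: "F = g * h"
    and low: "\<And>i. i < degree F \<Longrightarrow> p dvd coeff F i"
    and lead: "\<not> p dvd lead_coeff F" and const: "\<not> p\<^sup>2 dvd coeff F 0"
  shows "degree g = 0 \<or> degree h = 0"
proof (rule ccontr)
  assume "\<not> ?thesis"
  hence dg: "degree g > 0" and dh: "degree h > 0" by auto
  have nz: "g \<noteq> 0" "h \<noteq> 0" using dg dh by auto
  have dF: "degree F = degree g + degree h" using F nz by (simp add: degree_mult_eq)
  \<comment> \<open>Stated for an arbitrary pair so that it applies both to \<open>g\<close>,
    \<open>h\<close> and to \<open>h\<close>, \<open>g\<close>.\<close>
  have main: False if F': "F = a * b" and da: "degree a < degree F" "a \<noteq> 0"
    and pa: "p dvd coeff a 0" and pb: "\<not> p dvd coeff b 0" for a b :: "int poly"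
  proof -
    have "\<not> p dvd lead_coeff a"
      using lead F' by (auto simp: lead_coeff_mult)
    hence ex: "\<exists>i. \<not> p dvd coeff a i" by blast
    define i where "i = (LEAST i. \<not> p dvd coeff a i)"
    have i: "\<not> p dvd coeff a i" unfolding i_def using ex by (rule LeastI_ex)
    have less: "p dvd coeff a j" if "j < i" for j
      using that not_less_Least unfolding i_def by blast
    have "i \<le> degree a" using i le_degree[of a i] by fastforce
    hence "p dvd coeff F i" using low da by simp
    also have "coeff F i = (\<Sum>j\<le>i. coeff a j * coeff b (i - j))"
      by (simp add: F' coeff_mult)
    \<comment> \<open>By minimality of \<open>i\<close>, every term of the convolution except
      \<open>coeff a i * coeff b 0\<close> is divisible by \<open>p\<close>.\<close>
    also have "\<dots> = coeff a i * coeff b 0 + (\<Sum>j<i. coeff a j * coeff b (i - j))"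
      by (simp flip: lessThan_Suc_atMost)
    finally have "p dvd coeff a i * coeff b 0"
      using less by (subst (asm) dvd_add_left_iff) (auto intro: dvd_sum)
    thus False using i pb p by (simp add: prime_dvd_mult_iff)
  qed
  have c0: "coeff F 0 = coeff g 0 * coeff h 0" by (simp add: F coeff_mult_0)
  hence "p dvd coeff g 0 * coeff h 0" using low[of 0] dF dg by simp
  hence "p dvd coeff g 0 \<or> p dvd coeff h 0" using p by (simp add: prime_dvd_mult_iff)
  moreover have "\<not> (p dvd coeff g 0 \<and> p dvd coeff h 0)"
    using const c0 by (auto simp: power2_eq_square intro: mult_dvd_mono)
  ultimately show False
    using main[OF F] main[of h g] F dF dg dh nz by (auto simp: mult.commute)
qed

section \<open>Integer polynomials with a common complex root\<close>

lemma map_poly_of_int_add: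
  "map_poly of_int (f + g) = (map_poly of_int f + map_poly of_int g :: 'a::comm_ring_1 poly)"
  by (rule poly_eqI) (simp add: coeff_map_poly)

lemma map_poly_of_int_mult:
  "map_poly of_int (f * g) = (map_poly of_int f * map_poly of_int g :: 'a::comm_ring_1 poly)"
  by (rule poly_eqI) (simp add: coeff_map_poly coeff_mult)

lemma map_poly_of_int_sum:
  "map_poly of_int (\<Sum>i\<in>A. f i) = (\<Sum>i\<in>A. map_poly of_int (f i) :: 'a::comm_ring_1 poly)"
  by (induction A rule: infinite_finite_induct) (simp_all add: map_poly_of_int_add)

text \<open>A minimal polynomial argument carried out inside the integer polynomials. Content 1
  rules out constant non-unit factors and \<open>indec\<close> rules out proper factors of positive
  degree, so \<open>F\<close> is the primitive minimal polynomial of \<open>z\<close> up to a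
  unit.\<close>

lemma indecomposable_dvd_of_common_root:
  fixes F f :: "int poly" and z :: complex
  assumes Fz: "poly (map_poly of_int F) z = 0" and fz: "poly (map_poly of_int f) z = 0"
    and cF: "content F = 1"
    and indec: "\<And>g h. F = g * h \<Longrightarrow> degree g = 0 \<or> degree h = 0"
  shows "F dvd f"
proof -
  let ?root = "\<lambda>g::int poly. g \<noteq> 0 \<and> poly (map_poly of_int g) z = 0"
  have "?root F" using Fz cF by auto
  \<comment> \<open>Pseudo-division by a root polynomial of least degree: its primitive part divides all others.\<close>
  define g where "g = arg_min degree ?root"
  have g: "?root g" and gmin: "\<And>h. ?root h \<Longrightarrow> degree g \<le> degree h"
    using arg_min_nat_lemma[of ?root F degree] \<open>?root F\<close> unfolding g_def by auto
  have dvd: "primitive_part g dvd h" if hz: "poly (map_poly of_int h) z = 0" for h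
  proof -
    obtain a q where aq: "a \<noteq> 0" "smult a h = g * q + pseudo_mod h g"
      using pseudo_mod(1)[of g h] g by auto
    have "map_poly of_int (smult a h) = (map_poly of_int (g * q + pseudo_mod h g) :: complex poly)"
      using aq(2) by simp
    hence "poly (map_poly of_int (smult a h)) z = poly (map_poly of_int (g * q + pseudo_mod h g)) z"
      by (rule arg_cong)
    hence "poly (map_poly of_int (pseudo_mod h g)) z = 0"
      using g hz by (simp add: map_poly_of_int_add map_poly_of_int_mult map_poly_smult)
    hence "pseudo_mod h g = 0"
      using gmin[of "pseudo_mod h g"] pseudo_mod(2)[of g h] g by linarith
    hence "g dvd smult a h" using aq by simp
    hence "primitive_part g dvd primitive_part (smult a h)" by (rule primitive_part_dvd_primitive_partI)
    also have "primitive_part (smult a h) dvd primitive_part h"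
      using aq(1) by (cases "a > 0") (simp_all add: primitive_part_smult sgn_if)
    also have "primitive_part h dvd h"
      by (metis content_times_primitive_part dvd_smult dvd_refl)
    finally show ?thesis .
  qed
  obtain h where h: "F = primitive_part g * h" using dvd[OF Fz] by (elim dvdE)
  \<comment> \<open>A nonzero constant has no root, so the primitive part has positive degree and
    the cofactor \<open>h\<close> must be constant; comparing contents makes it a unit.\<close>
  have "degree (primitive_part g) \<noteq> 0"
  proof
    assume "degree (primitive_part g) = 0"
    then obtain c where "g = [:c:]" by (metis degree_primitive_part degree_eq_zeroE)
    thus False using g by (simp add: map_poly_pCons)
  qed
  hence "degree h = 0" using indec[OF h] by simp
  then obtain c where c: "h = [:c:]" by (metis degree_eq_zeroE)
  have "content F = content h" using g by (simp add: h content_mult)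
  hence "is_unit c" using cF c by simp
  hence "F dvd primitive_part g" 
    unfolding h c by (cases "c > 0") (auto simp: zdvd1_eq abs_if split: if_splits)
  thus ?thesis using dvd[OF fz] by (rule dvd_trans)
qed

section \<open>Irreducibility of the cyclotomic polynomial of prime power order\<close>

text \<open>For prime \<open>p\<close> this is the cyclotomic polynomial of order
  \<open>p ^ Suc n\<close>, not \<open>p ^ n\<close>: the index is chosen to match the level
  \<open>n\<close> of the residue tree.\<close>

definition prime_power_cyclotomic :: "nat \<Rightarrow> nat \<Rightarrow> int poly" where
  "prime_power_cyclotomic p n = (\<Sum>i<p. monom 1 (i * p ^ n))"

lemma cyclotomic_mult_monom:
  "prime_power_cyclotomic p n * (monom 1 (p ^ n) - 1) = monom 1 (p ^ Suc n) - 1"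
proof -
  have "prime_power_cyclotomic p n = (\<Sum>i<p. monom 1 (p ^ n) ^ i)"
    by (simp add: prime_power_cyclotomic_def monom_power mult.commute)
  moreover have "monom 1 (p ^ Suc n) = (monom 1 (p ^ n) ^ p :: int poly)"
    by (simp add: monom_power mult.commute)
  ultimately show ?thesis
    using power_diff_1_eq[of "monom 1 (p ^ n) :: int poly" p] by (simp add: mult.commute)
qed

lemma degree_monom_minus_1:
  assumes "m > 0"
  shows "degree (monom 1 m - 1 :: int poly) = m" "lead_coeff (monom 1 m - 1 :: int poly) = 1"
proof -
  show *: "degree (monom 1 m - 1 :: int poly) = m"
    using assms by (intro antisym degree_le le_degree) auto
  show "lead_coeff (monom 1 m - 1 :: int poly) = 1" unfolding * using assms by simp
qed

text \<open>Both facts are read off by comparing the two sides of the product formula, whose other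
  factors are monic of known degree.\<close>

lemma cyclotomic_monic:
  assumes "prime p"
  shows "degree (prime_power_cyclotomic p n) = (p - 1) * p ^ n"
    and "lead_coeff (prime_power_cyclotomic p n) = 1"
proof -
  let ?P = "prime_power_cyclotomic p n"
  have p: "p > 0" using assms by (rule prime_gt_0_nat)
  have nz: "?P \<noteq> 0" "monom 1 (p ^ n) - 1 \<noteq> (0 :: int poly)"
    using cyclotomic_mult_monom[of p n] degree_monom_minus_1[of "p ^ Suc n"] 
      degree_monom_minus_1[of "p ^ n"] p by auto
  have "degree ?P + p ^ n = p ^ Suc n"
    using arg_cong[OF cyclotomic_mult_monom[of p n], of degree] nz p
    by (simp add: degree_mult_eq degree_monom_minus_1)
  thus "degree ?P = (p - 1) * p ^ n" by (simp add: algebra_simps)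
  show "lead_coeff ?P = 1"
    using arg_cong[OF cyclotomic_mult_monom[of p n], of lead_coeff] p
    using degree_monom_minus_1(2)[of "p ^ n"] degree_monom_minus_1(2)[of "p ^ Suc n"]
    by (simp only: lead_coeff_mult zero_less_power mult_1_right)
qed

text \<open>The Frobenius congruence modulo \<open>p\<close>, phrased as divisibility so that it can
  be used for integer polynomials without passing to a quotient ring.\<close>

lemma prime_dvd_binomial_power:
  fixes a :: "'a::comm_ring_1"
  assumes "prime p"
  shows "of_nat p dvd (1 + a) ^ p - (1 + a ^ p)"
proof -
  have p: "p > 0" using assms by (rule prime_gt_0_nat)
  have "(1 + a) ^ p = (\<Sum>k\<le>p. of_nat (p choose k) * a ^ k)"
    using binomial_ring[of a 1 p] by (simp add: add.commute)
  also have "{..p} = insert 0 (insert p {0<..<p})" using p by auto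
  also have "(\<Sum>k\<in>\<dots>. of_nat (p choose k) * a ^ k) = 1 + a ^ p + (\<Sum>k\<in>{0<..<p}. of_nat (p choose k) * a ^ k)"
    using p by (simp add: add.assoc)
  finally have "(1 + a) ^ p - (1 + a ^ p) = (\<Sum>k\<in>{0<..<p}. of_nat (p choose k) * a ^ k)" by simp
  moreover have "of_nat p dvd (of_nat (p choose k) * a ^ k :: 'a)" if "k \<in> {0<..<p}" for k
  proof -
    have "p dvd p choose k" using that assms by (intro dvd_choose_prime) auto
    thus ?thesis by (auto elim!: dvdE)
  qed
  ultimately show ?thesis by (auto intro: dvd_sum)
qed

lemma prime_dvd_binomial_prime_power:
  fixes a :: "'a::comm_ring_1"
  assumes "prime p"
  shows "of_nat p dvd (1 + a) ^ (p ^ n) - (1 + a ^ (p ^ n))"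
proof (induction n)
  case (Suc n)
  let ?x = "(1 + a) ^ (p ^ n)" and ?y = "1 + a ^ (p ^ n)"
  \<comment> \<open>A congruence modulo \<open>p\<close> survives raising to the power
    \<open>p\<close>; one more Frobenius step then treats \<open>?y ^ p\<close>.\<close>
  have "?x - ?y dvd ?x ^ p - ?y ^ p" by (simp add: power_diff_sumr2)
  hence "of_nat p dvd ?x ^ p - ?y ^ p" using Suc.IH dvd_trans by blast
  from dvd_add[OF this prime_dvd_binomial_power[OF assms, of "a ^ (p ^ n)"]]
  show ?case by (simp add: mult.commute algebra_simps flip: power_mult)
qed simp

lemma pcompose_monom_1: "pcompose (monom 1 m) q = (q ^ m :: 'a::comm_ring_1 poly)"
  by (induction m) (simp_all add: monom_Suc pcompose_pCons monom_0)

text \<open>Substituting \<open>X + 1\<close> preserves degrees and turns the value \<open>p\<close>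
  at 1 into the constant term, which is divisible by \<open>p\<close> exactly once.\<close>

lemma cyclotomic_indecomposable:
  assumes p: "prime p" and gh: "prime_power_cyclotomic p n = g * h"
  shows "degree g = 0 \<or> degree h = 0"
proof -
  let ?P = "prime_power_cyclotomic p n" and ?X = "[:0, 1:] :: int poly"
  \<comment> \<open>Modulo \<open>p\<close>, the shifted polynomial times \<open>X ^ (p ^ n)\<close> is \<open>X ^ (p ^ Suc n)\<close>, so Eisenstein applies.\<close>
  define F where "F = pcompose ?P [:1, 1:]"
  have X1: "[:1, 1:] = 1 + ?X" by (simp add: one_pCons)
  have p0: "p > 0" using p by (rule prime_gt_0_nat)
  have degF: "degree F = (p - 1) * p ^ n" "lead_coeff F = 1"
    using cyclotomic_monic[OF p, of n] unfolding F_def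
    using lead_coeff_comp[of "[:1, 1:]" ?P] by (simp_all add: degree_pcompose)
  have shift: "F * ((1 + ?X) ^ (p ^ n) - 1) = (1 + ?X) ^ (p ^ Suc n) - 1"
    using arg_cong[OF cyclotomic_mult_monom[of p n], of "\<lambda>f. pcompose f (1 + ?X)"]
    unfolding F_def X1 by (simp add: pcompose_mult pcompose_diff pcompose_1 pcompose_monom_1)
  obtain R where R: "(1 + ?X) ^ (p ^ n) - (1 + ?X ^ (p ^ n)) = of_nat p * R"
    using prime_dvd_binomial_prime_power[OF p, of ?X n] by (elim dvdE)
  obtain R' where R': "(1 + ?X) ^ (p ^ Suc n) - (1 + ?X ^ (p ^ Suc n)) = of_nat p * R'"
    using prime_dvd_binomial_prime_power[OF p, of ?X "Suc n"] by (elim dvdE)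
  have "F * ?X ^ (p ^ n) = ?X ^ (p ^ Suc n) + of_nat p * (R' - F * R)"
  proof -
    have "(1 + ?X) ^ (p ^ n) - 1 = ?X ^ (p ^ n) + of_nat p * R"
      by (simp flip: R)
    moreover have "(1 + ?X) ^ (p ^ Suc n) - 1 = ?X ^ (p ^ Suc n) + of_nat p * R'"
      by (simp flip: R')
    ultimately show ?thesis using shift by (simp only:) (simp add: algebra_simps)
  qed
  hence eq: "F * monom 1 (p ^ n) = monom 1 (p ^ Suc n) + of_nat p * (R' - F * R)"
    by (simp add: monom_altdef)
  \<comment> \<open>Coefficient \<open>i\<close> of \<open>F\<close> sits at position
    \<open>i + p ^ n\<close> of the product. Since \<open>degree F + p ^ n = p ^ Suc n\<close>, this
    lies below the leading monomial, and only the multiple of \<open>p\<close> contributes.\<close>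
  have low: "int p dvd coeff F i" if "i < degree F" for i
  proof -
    have "coeff F i = coeff (F * monom 1 (p ^ n)) (i + p ^ n)"
      by (simp add: mult.commute[of F] coeff_monom_mult)
    also have "\<dots> = int p * coeff (R' - F * R) (i + p ^ n)"
      using that p0 unfolding eq degF(1) by (simp add: of_nat_poly algebra_simps)
    finally show ?thesis by simp
  qed
  have "coeff F 0 = poly ?P 1" by (simp add: F_def poly_pcompose flip: poly_0_coeff_0)
  also have "\<dots> = int p" by (simp add: prime_power_cyclotomic_def poly_sum poly_monom)
  finally have c0: "coeff F 0 = int p" .
  have np: "\<not> int p dvd 1" "\<not> (int p)\<^sup>2 dvd int p"
    using prime_gt_1_nat[OF p] by (auto simp: power2_eq_square)
  have "F = pcompose g [:1, 1:] * pcompose h [:1, 1:]" by (simp add: F_def gh pcompose_mult)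
  from eisenstein_factor_degree[OF _ this low] p np degF(2) c0
  show ?thesis by (simp add: degree_pcompose)
qed

text \<open>The two conditions on \<open>z\<close> say that it is a primitive root of unity of order
  \<open>p ^ Suc n\<close>; its \<open>p ^ n\<close>-th power is then a \<open>p\<close>-th root of
  unity other than 1, whose geometric sum vanishes.\<close>

lemma cyclotomic_dvd_of_root:
  fixes f :: "int poly" and z :: complex
  assumes p: "prime p" and z: "z ^ (p ^ n) \<noteq> 1" "z ^ (p ^ Suc n) = 1"
    and f: "poly (map_poly of_int f) z = 0"
  shows "prime_power_cyclotomic p n dvd f"
proof (rule indecomposable_dvd_of_common_root[OF _ f])
  let ?P = "prime_power_cyclotomic p n"
  have "poly (map_poly of_int ?P) z = (\<Sum>i<p. (z ^ (p ^ n)) ^ i)"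
    by (simp add: prime_power_cyclotomic_def map_poly_of_int_sum map_poly_monom poly_sum
        poly_monom mult.commute flip: power_mult)
  also have "\<dots> = 0" 
    using z by (subst sum_gp_strict) (simp add: mult.commute flip: power_mult)
  finally show "poly (map_poly of_int ?P) z = 0" .
  have "content ?P dvd lead_coeff ?P" by (rule content_dvd_coeff)
  hence "is_unit (content ?P)" by (simp only: cyclotomic_monic(2)[OF p])
  thus "content ?P = 1" by (simp only: is_unit_content_iff)
  show "degree g = 0 \<or> degree h = 0" if "?P = g * h" for g h
    using cyclotomic_indecomposable[OF p that] .
qed

text \<open>The polynomial with coefficients \<open>a\<close> is a multiple of the cyclotomic one.
  By degrees the quotient \<open>g\<close> has only coefficients below \<open>p ^ n\<close>, and
  multiplication by the cyclotomic polynomial writes that block \<open>p\<close> times in a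
  row.\<close>

lemma vanishing_root_sum_coeffs:
  fixes a :: "nat \<Rightarrow> int" and z :: complex
  assumes p: "prime p" and z: "z ^ (p ^ n) \<noteq> 1" "z ^ (p ^ Suc n) = 1"
    and sum: "(\<Sum>j<p ^ Suc n. of_int (a j) * z ^ j) = 0"
    and i: "i < p" and r: "r < p ^ n"
  shows "a (i * p ^ n + r) = a r"
proof -
  let ?P = "prime_power_cyclotomic p n"
  define f where "f = (\<Sum>j<p ^ Suc n. monom (a j) j)"
  have coeff_f: "coeff f j = (if j < p ^ Suc n then a j else 0)" for j
    by (simp add: f_def coeff_sum)
  have "poly (map_poly of_int f) z = 0"
    using sum by (simp add: f_def map_poly_of_int_sum map_poly_monom poly_sum poly_monom)
  from cyclotomic_dvd_of_root[OF p z this] obtain g where g: "f = ?P * g" by (elim dvdE)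
  have p0: "p > 0" using p by (rule prime_gt_0_nat)
  have gdeg: "coeff g m = 0" if "m \<ge> p ^ n" for m
  proof (rule ccontr)
    assume "coeff g m \<noteq> 0"
    hence "g \<noteq> 0" "m \<le> degree g" by (auto intro: le_degree)
    moreover have "?P \<noteq> 0" using cyclotomic_monic[OF p, of n] by auto
    ultimately have "degree f \<ge> (p - 1) * p ^ n + p ^ n" "f \<noteq> 0"
      using that by (auto simp: g degree_mult_eq cyclotomic_monic[OF p])
    hence "degree f \<ge> p ^ Suc n" "lead_coeff f \<noteq> 0" using p0 by (auto simp: algebra_simps)
    thus False by (simp add: coeff_f)
  qed
  have "a (i * p ^ n + r) = coeff g r" if i: "i < p" for i
  proof -
    have "i * p ^ n + r < Suc i * p ^ n" using r by simp
    also have "\<dots> \<le> p ^ Suc n" using i by (simp add: mult_le_mono1 del: mult_Suc)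
    finally have "a (i * p ^ n + r) = coeff f (i * p ^ n + r)" by (simp add: coeff_f)
    also have "\<dots> = (\<Sum>k<p. coeff (monom 1 (k * p ^ n) * g) (i * p ^ n + r))"
      by (simp add: g prime_power_cyclotomic_def sum_distrib_right coeff_sum)
    \<comment> \<open>The shifts of \<open>g\<close> by distinct multiples of \<open>p ^ n\<close>
      occupy disjoint blocks, so only \<open>k = i\<close> survives.\<close>
    also have "\<dots> = (\<Sum>k<p. if k = i then coeff g r else 0)"
    proof (rule sum.cong[OF refl])
      fix k
      consider "k < i" | "k = i" | "k > i" by linarith
      thus "coeff (monom 1 (k * p ^ n) * g) (i * p ^ n + r) = (if k = i then coeff g r else 0)"
      proof cases
        case 1
        have "Suc k * p ^ n \<le> i * p ^ n" using 1 by (intro mult_le_mono1) simp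
        hence "p ^ n \<le> i * p ^ n + r - k * p ^ n" by simp
        thus ?thesis using 1 gdeg by (simp add: coeff_monom_mult)
      next
        case 2
        thus ?thesis by (simp add: coeff_monom_mult)
      next
        case 3
        have "Suc i * p ^ n \<le> k * p ^ n" using 3 by (intro mult_le_mono1) simp
        thus ?thesis using 3 r by (simp add: coeff_monom_mult)
      qed
    qed
    finally show ?thesis using i by simp
  qed
  from this[OF i] this[OF p0] show ?thesis by simp
qed

subsection \<open>The tree of residues\<close>

definition fibre_count :: "nat set \<Rightarrow> nat \<Rightarrow> nat \<Rightarrow> nat" where
  "fibre_count C m r = card {x \<in> C. x mod m = r}"

text \<open>The residues \<open>i * p ^ n + r\<close> with \<open>i < p\<close> are the possible
  children of the vertex \<open>r\<close>; all are compared with the child \<open>i = 0\<close>. At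
  an \<open>r\<close> that is no residue of \<open>C\<close> all counts are 0.\<close>

definition equidist :: "nat \<Rightarrow> nat set \<Rightarrow> nat \<Rightarrow> bool" where
  "equidist p C n \<longleftrightarrow>
     (\<forall>i<p. \<forall>r<p ^ n. fibre_count C (p ^ Suc n) (i * p ^ n + r) = fibre_count C (p ^ Suc n) r)"

text \<open>Phrased with points of \<open>C\<close> rather than residues, so that two points first
  differing at digit \<open>n\<close> are immediate witnesses.\<close>

definition branches :: "nat \<Rightarrow> nat set \<Rightarrow> nat \<Rightarrow> bool" where
  "branches p C n \<longleftrightarrow>
     (\<exists>x\<in>C. \<exists>y\<in>C. x mod p ^ n = y mod p ^ n \<and> x mod p ^ Suc n \<noteq> y mod p ^ Suc n)"

definition children :: "nat \<Rightarrow> nat set \<Rightarrow> nat \<Rightarrow> nat \<Rightarrow> nat set" where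
  "children p C n x = {y \<in> red C (p ^ Suc n). y mod p ^ n = x}"

text \<open>Grouping points by their residue modulo \<open>p ^ Suc n\<close> gives a sum of powers
  of \<open>z\<close> with the fibre counts as integer coefficients. Its vanishing forces these to
  be periodic in the top digit; conversely, periodicity lets a vanishing geometric sum be factored
  out.\<close>

lemma root_sum_zero_iff_equidist:
  fixes z :: complex
  assumes p: "prime p" and C: "finite C" and z: "z ^ (p ^ n) \<noteq> 1" "z ^ (p ^ Suc n) = 1"
  shows "(\<Sum>x\<in>C. z ^ x) = 0 \<longleftrightarrow> equidist p C n"
proof -
  let ?M = "p ^ Suc n" and ?q = "p ^ n"
  let ?a = "\<lambda>j. int (fibre_count C ?M j)"
  have M: "?M > 0" using prime_gt_0_nat[OF p] by simp
  have zmod: "z ^ x = z ^ (x mod ?M)" for x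
  proof -
    have "z ^ x = z ^ (?M * (x div ?M) + x mod ?M)" by simp
    also have "\<dots> = z ^ (x mod ?M)" by (simp only: power_add power_mult z power_one mult_1)
    finally show ?thesis .
  qed
  have "(\<Sum>x\<in>C. z ^ x) = (\<Sum>j<?M. \<Sum>x\<in>{x \<in> C. x mod ?M = j}. z ^ x)"
    using C M by (intro sum.group[symmetric]) auto
  also have "\<dots> = (\<Sum>j<?M. of_int (?a j) * z ^ j)"
  proof (rule sum.cong[OF refl])
    fix j
    have "(\<Sum>x\<in>{x \<in> C. x mod ?M = j}. z ^ x) = (\<Sum>x\<in>{x \<in> C. x mod ?M = j}. z ^ j)"
      using zmod by (intro sum.cong) auto
    thus "(\<Sum>x\<in>{x \<in> C. x mod ?M = j}. z ^ x) = of_int (?a j) * z ^ j"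
      by (simp add: fibre_count_def)
  qed
  finally have S: "(\<Sum>x\<in>C. z ^ x) = (\<Sum>j<?M. of_int (?a j) * z ^ j)" .
  show ?thesis
  proof
    assume "(\<Sum>x\<in>C. z ^ x) = 0"
    hence "(\<Sum>j<?M. of_int (?a j) * z ^ j) = 0" using S by simp
    from vanishing_root_sum_coeffs[OF p z this] show "equidist p C n"
      unfolding equidist_def by (simp only: of_nat_eq_iff) simp
  next
    assume eq: "equidist p C n"
    have "(\<Sum>x\<in>C. z ^ x) = (\<Sum>i<p. \<Sum>j\<in>{i * ?q..<i * ?q + ?q}. of_int (?a j) * z ^ j)"
      unfolding S by (simp add: sum.nat_group)
    also have "\<dots> = (\<Sum>i<p. \<Sum>r<?q. of_int (?a (i * ?q + r)) * z ^ (i * ?q + r))"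
    proof (rule sum.cong[OF refl])
      fix i
      show "(\<Sum>j\<in>{i * ?q..<i * ?q + ?q}. of_int (?a j) * z ^ j)
          = (\<Sum>r<?q. of_int (?a (i * ?q + r)) * z ^ (i * ?q + r))"
        by (rule sum.reindex_bij_witness[of _ "\<lambda>r. i * ?q + r" "\<lambda>j. j - i * ?q"]) auto
    qed
    also have "\<dots> = (\<Sum>i<p. \<Sum>r<?q. (z ^ ?q) ^ i * (of_int (?a r) * z ^ r))"
      using eq unfolding equidist_def
      by (intro sum.cong refl) (simp add: power_add mult.commute[of _ ?q] power_mult)
    also have "\<dots> = (\<Sum>i<p. (z ^ ?q) ^ i) * (\<Sum>r<?q. of_int (?a r) * z ^ r)"
      by (simp add: sum_product)
    also have "(\<Sum>i<p. (z ^ ?q) ^ i) = 0"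
      using z by (subst sum_gp_strict) (simp add: mult.commute flip: power_mult)
    finally show "(\<Sum>x\<in>C. z ^ x) = 0" by simp
  qed
qed

section \<open>Character sums over a set\<close>

lemma cis_2pi_frac_eq_1_iff:
  assumes "m > 0"
  shows "cis (2 * pi * of_int u / real m) = 1 \<longleftrightarrow> int m dvd u"
proof
  assume "cis (2 * pi * of_int u / real m) = 1"
  hence "cos (2 * pi * of_int u / real m) = 1" by (metis cis.sel(1) one_complex.sel(1))
  then obtain k :: int where "2 * pi * of_int u / real m = of_int k * 2 * pi"
    by (auto simp: cos_one_2pi_int)
  hence "real_of_int u = of_int (k * int m)" using assms by (simp add: field_simps)
  hence "u = k * int m" by (simp only: of_int_eq_iff)
  thus "int m dvd u" by simp
next
  assume "int m dvd u"
  then obtain k where "u = int m * k" by (elim dvdE)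
  hence "2 * pi * of_int u / real m = 2 * pi * of_int k" using assms by simp
  thus "cis (2 * pi * of_int u / real m) = 1" by simp
qed

text \<open>A frequency of \<open>p\<close>-adic valuation \<open>l\<close> gives a primitive root
  of unity of order \<open>p ^ (\<gamma> - l)\<close>, hence tests level
  \<open>\<gamma> - 1 - l\<close>. The cofactor \<open>u\<close> is an integer because differences
  of frequencies and the sign in the Fourier transform can be negative.\<close>

lemma character_sum_zero_iff_equidist:
  assumes p: "prime p" and C: "finite C" and u: "\<not> int p dvd u" and l: "l < \<gamma>"
  shows "(\<Sum>x\<in>C. cis (2 * pi * of_int (int p ^ l * u) * real x / real (p ^ \<gamma>))) = 0
     \<longleftrightarrow> equidist p C (\<gamma> - 1 - l)"
proof -
  define n where "n = \<gamma> - 1 - l"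
  define z where "z = cis (2 * pi * of_int u / real (p ^ Suc n))"
  have p0: "p > 0" using p by (rule prime_gt_0_nat)
  have \<gamma>: "p ^ \<gamma> = p ^ l * p ^ Suc n" using l unfolding power_add[symmetric] n_def by simp
  have "z ^ (p ^ n) = cis (2 * pi * of_int u / real p)"
    using p0 by (simp add: z_def DeMoivre)
  hence z1: "z ^ (p ^ n) \<noteq> 1" using cis_2pi_frac_eq_1_iff[OF p0] u by simp
  have "z ^ (p ^ Suc n) = cis (2 * pi * of_int u)"
    using p0 by (simp add: z_def DeMoivre)
  hence z2: "z ^ (p ^ Suc n) = 1" by simp
  have "cis (2 * pi * of_int (int p ^ l * u) * real x / real (p ^ \<gamma>)) = z ^ x" for x
    unfolding z_def \<gamma> DeMoivre using p0 by (intro arg_cong[of _ _ cis]) (simp add: field_simps)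
  thus ?thesis
    using root_sum_zero_iff_equidist[OF p C z1 z2] by (simp add: n_def)
qed

section \<open>Children of a vertex in the residue tree\<close>

lemma finite_red: "finite C \<Longrightarrow> finite (red C m)"
  by (simp add: red_def)

lemma red_1: "C \<noteq> {} \<Longrightarrow> red C 1 = {0}"
  by (auto simp: red_def)

lemma red_id: "C \<subseteq> {..<m} \<Longrightarrow> red C m = C"
  by (force simp: red_def)

lemma fibre_count_pos_iff: "finite C \<Longrightarrow> fibre_count C m r > 0 \<longleftrightarrow> r \<in> red C m"
  by (auto simp: fibre_count_def red_def card_gt_0_iff)

lemma red_Suc_mod: "(\<lambda>y. y mod p ^ n) ` red C (p ^ Suc n) = red C (p ^ n)"
  by (auto simp: red_def image_image mod_mod_cancel)

lemma finite_children: "finite C \<Longrightarrow> finite (children p C n x)"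
  by (simp add: children_def finite_red)

lemma card_red_Suc:
  assumes "finite C"
  shows "card (red C (p ^ Suc n)) = (\<Sum>x\<in>red C (p ^ n). card (children p C n x))"
proof -
  have "(\<Sum>x\<in>red C (p ^ n). \<Sum>y\<in>{y \<in> red C (p ^ Suc n). y mod p ^ n = x}. 1)
      = (\<Sum>y\<in>red C (p ^ Suc n). 1::nat)"
    using assms red_Suc_mod[of p n C] by (intro sum.group finite_red) auto
  thus ?thesis by (simp add: children_def)
qed

lemma children_nonempty:
  assumes "x \<in> red C (p ^ n)"
  shows "children p C n x \<noteq> {}"
proof -
  have "x \<in> (\<lambda>y. y mod p ^ n) ` red C (p ^ Suc n)" using assms by (simp only: red_Suc_mod)
  thus ?thesis by (auto simp: children_def)
qed

lemma card_children_ge_1: "finite C \<Longrightarrow> x \<in> red C (p ^ n) \<Longrightarrow> card (children p C n x) \<ge> 1"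
  by (simp add: Suc_le_eq card_gt_0_iff finite_children children_nonempty)

lemma children_subset:
  assumes "p > 0"
  shows "children p C n x \<subseteq> (\<lambda>i. i * p ^ n + x) ` {..<p}"
proof
  fix y assume "y \<in> children p C n x"
  hence "y < p * p ^ n" "y mod p ^ n = x" using assms by (auto simp: children_def red_def)
  hence "y div p ^ n < p" "y = (y div p ^ n) * p ^ n + x"
    using div_mult_mod_eq[of y "p ^ n"] by (simp_all only: less_mult_imp_div_less)
  thus "y \<in> (\<lambda>i. i * p ^ n + x) ` {..<p}" by blast
qed

lemma card_digit_image: "p > 0 \<Longrightarrow> card ((\<lambda>i. i * p ^ n + x) ` {..<p}) = (p::nat)"
  by (subst card_image) (auto simp: inj_on_def)

lemma card_children_le:
  assumes "p > 0"
  shows "card (children p C n x) \<le> p"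
  using card_mono[OF _ children_subset[OF assms]] card_digit_image[OF assms] by fastforce

lemma card_children_eq_p_iff:
  assumes "p > 0"
  shows "card (children p C n x) = p \<longleftrightarrow> children p C n x = (\<lambda>i. i * p ^ n + x) ` {..<p}"
  using card_subset_eq[OF _ children_subset[OF assms]] card_digit_image[OF assms] by fastforce

text \<open>A vertex has at least one child; equal fibre counts then make all \<open>p\<close>
  possible children occur.\<close>

lemma equidist_card_children:
  assumes p: "p > 0" and C: "finite C" and eq: "equidist p C n" and x: "x \<in> red C (p ^ n)"
  shows "card (children p C n x) = p"
proof -
  have xlt: "x < p ^ n" using x p by (auto simp: red_def)
  obtain i\<^sub>0 where i\<^sub>0: "i\<^sub>0 < p" "i\<^sub>0 * p ^ n + x \<in> red C (p ^ Suc n)"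
    using children_nonempty[OF x] children_subset[OF p, of C n x] by (fastforce simp: children_def)
  have "i * p ^ n + x \<in> red C (p ^ Suc n)" if "i < p" for i
  proof -
    have "fibre_count C (p ^ Suc n) (i * p ^ n + x) = fibre_count C (p ^ Suc n) (i\<^sub>0 * p ^ n + x)"
      using eq that i\<^sub>0(1) xlt by (simp add: equidist_def)
    thus ?thesis using i\<^sub>0(2) fibre_count_pos_iff[OF C] by metis
  qed
  hence "children p C n x = (\<lambda>i. i * p ^ n + x) ` {..<p}"
    using children_subset[OF p, of C n x] xlt by (auto simp: children_def)
  thus ?thesis using card_children_eq_p_iff[OF p] by blast
qed

lemma not_branches_card_children:
  assumes C: "finite C" and nb: "\<not> branches p C n" and x: "x \<in> red C (p ^ n)"
  shows "card (children p C n x) = 1"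
proof -
  have "y = y'" if "y \<in> children p C n x" "y' \<in> children p C n x" for y y'
  proof -
    from that obtain a b where ab: "a \<in> C" "b \<in> C" "y = a mod p ^ Suc n" "y' = b mod p ^ Suc n"
      "y mod p ^ n = x" "y' mod p ^ n = x"
      by (auto simp: children_def red_def)
    hence "a mod p ^ n = b mod p ^ n" by (auto simp: mod_mod_cancel)
    hence "a mod p ^ Suc n = b mod p ^ Suc n"
      using nb ab(1,2) unfolding branches_def by blast
    thus ?thesis by (simp only: ab)
  qed
  hence "card (children p C n x) \<le> 1"
    using card_le_Suc0_iff_eq[OF finite_children[OF C]] by auto
  thus ?thesis using card_children_ge_1[OF C x] by linarith
qed

lemma branches_card_children:
  assumes C: "finite C" and "branches p C n"
  shows "\<exists>x\<in>red C (p ^ n). card (children p C n x) \<noteq> 1"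
proof -
  obtain a b where ab: "a \<in> C" "b \<in> C" "a mod p ^ n = b mod p ^ n" "a mod p ^ Suc n \<noteq> b mod p ^ Suc n"
    using assms(2) by (auto simp: branches_def)
  hence "a mod p ^ Suc n \<in> children p C n (a mod p ^ n)" "b mod p ^ Suc n \<in> children p C n (a mod p ^ n)"
    by (auto simp: children_def red_def mod_mod_cancel)
  hence "card (children p C n (a mod p ^ n)) \<noteq> 1"
    using ab(4) by (metis card_1_singletonE singletonD)
  thus ?thesis using ab(1) by (auto simp: red_def)
qed

lemma equidist_imp_branches:
  assumes p: "p > 1" and C: "finite C" "C \<noteq> {}" and eq: "equidist p C n"
  shows "branches p C n"
proof (rule ccontr)
  assume nb: "\<not> branches p C n"
  obtain x where x: "x \<in> red C (p ^ n)" using C by (auto simp: red_def)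
  show False
    using equidist_card_children[OF _ C(1) eq x] not_branches_card_children[OF C(1) nb x] p by simp
qed

section \<open>Homogeneity, branching and equidistribution\<close>

lemma p_homogeneous_children:
  "p_homogeneous p \<gamma> C \<longleftrightarrow> (\<forall>n<\<gamma>. (\<forall>x\<in>red C (p ^ n). card (children p C n x) = 1)
      \<or> (\<forall>x\<in>red C (p ^ n). card (children p C n x) = p))"
  by (simp add: p_homogeneous_def children_def)

lemma fibre_count_Suc:
  assumes "finite C"
  shows "fibre_count C (p ^ n) x = (\<Sum>y\<in>children p C n x. fibre_count C (p ^ Suc n) y)"
proof -
  let ?A = "{a \<in> C. a mod p ^ n = x}"
  have "(\<Sum>y\<in>children p C n x. \<Sum>a\<in>{a \<in> ?A. a mod p ^ Suc n = y}. 1) = (\<Sum>a\<in>?A. 1::nat)"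
    using assms by (intro sum.group finite_children) (auto simp: children_def red_def mod_mod_cancel)
  moreover have "{a \<in> ?A. a mod p ^ Suc n = y} = {a \<in> C. a mod p ^ Suc n = y}"
    if "y \<in> children p C n x" for y
    using that by (auto simp: children_def mod_mod_cancel)
  ultimately show ?thesis by (simp add: fibre_count_def)
qed

text \<open>Downward induction from level \<open>\<gamma>\<close>, where fibres are singletons: each
  step multiplies the common count by the common number of children.\<close>

lemma p_homogeneous_fibre_count_const:
  assumes p: "p > 0" and hom: "p_homogeneous p \<gamma> C" and C: "C \<subseteq> {..<p ^ \<gamma>}" and "m \<le> \<gamma>"
  shows "\<exists>c. \<forall>x\<in>red C (p ^ m). fibre_count C (p ^ m) x = c"
  using \<open>m \<le> \<gamma>\<close>
proof (induction rule: inc_induct)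
  case base
  have "fibre_count C (p ^ \<gamma>) x = 1" if "x \<in> red C (p ^ \<gamma>)" for x
  proof -
    have "{a \<in> C. a mod p ^ \<gamma> = x} = {x}" using that C red_id[OF C] by auto
    thus ?thesis by (simp add: fibre_count_def)
  qed
  thus ?case by blast
next
  case (step n)
  have fin: "finite C" using C finite_subset by blast
  from step obtain c where c: "\<And>x. x \<in> red C (p ^ Suc n) \<Longrightarrow> fibre_count C (p ^ Suc n) x = c"
    by blast
  have "fibre_count C (p ^ n) x = card (children p C n x) * c" for x
    using fibre_count_Suc[OF fin, of p n x] c by (simp add: children_def)
  thus ?case using hom step.hyps unfolding p_homogeneous_children by metis
qed

text \<open>Homogeneity counts children, equidistribution counts points. Constancy of the fibre
  counts along a level passes from the first to the second.\<close>

lemma p_homogeneous_iff_branches: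
  assumes p: "p > 0" and C: "C \<subseteq> {..<p ^ \<gamma>}"
  shows "p_homogeneous p \<gamma> C \<longleftrightarrow> (\<forall>n<\<gamma>. branches p C n \<longrightarrow> equidist p C n)"
proof
  have fin: "finite C" using C finite_subset by blast
  {
    assume *: "\<forall>n<\<gamma>. branches p C n \<longrightarrow> equidist p C n"
    show "p_homogeneous p \<gamma> C"
      unfolding p_homogeneous_children
      using * equidist_card_children[OF p fin] not_branches_card_children[OF fin] by blast
  }
  assume hom: "p_homogeneous p \<gamma> C"
  show "\<forall>n<\<gamma>. branches p C n \<longrightarrow> equidist p C n"
  proof (intro allI impI)
    fix n assume n: "n < \<gamma>" and br: "branches p C n"
    have ch: "card (children p C n x) = p" if "x \<in> red C (p ^ n)" for x
      using hom branches_card_children[OF fin br] n that unfolding p_homogeneous_children by blast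
    obtain c where c: "\<And>x. x \<in> red C (p ^ Suc n) \<Longrightarrow> fibre_count C (p ^ Suc n) x = c"
      using p_homogeneous_fibre_count_const[OF p hom C, of "Suc n"] n by auto
    \<comment> \<open>The value does not depend on \<open>i\<close>: all children of an occurring
      vertex carry \<open>c\<close> points, all children of a missing one carry none.\<close>
    have val: "fibre_count C (p ^ Suc n) (i * p ^ n + r) = (if r \<in> red C (p ^ n) then c else 0)"
      if "i < p" "r < p ^ n" for i r
    proof (cases "r \<in> red C (p ^ n)")
      case True
      hence "i * p ^ n + r \<in> children p C n r"
        using ch[OF True] that card_children_eq_p_iff[OF p] by blast
      thus ?thesis using c True by (simp add: children_def)
    next
      case False
      hence "i * p ^ n + r \<notin> red C (p ^ Suc n)"
        using that red_Suc_mod[of p n C] by (metis image_eqI mod_less mod_mult_self3)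
      thus ?thesis using False fibre_count_pos_iff[OF fin] by (metis neq0_conv)
    qed
    show "equidist p C n"
      unfolding equidist_def using val val[of 0] p by simp
  qed
qed

section \<open>Counting along the levels\<close>

text \<open>Every vertex has between 1 and \<open>p\<close> children; equidistribution forces
  \<open>p\<close> and absence of branching forces 1.\<close>

lemma card_red_Suc_bounds:
  assumes p: "p > 0" and C: "finite C"
  shows "card (red C (p ^ n)) * (if equidist p C n then p else 1) \<le> card (red C (p ^ Suc n))"
    and "card (red C (p ^ Suc n)) \<le> card (red C (p ^ n)) * (if branches p C n then p else 1)"
proof -
  let ?R = "red C (p ^ n)"
  have "(\<Sum>x\<in>?R. (if equidist p C n then p else 1)) \<le> (\<Sum>x\<in>?R. card (children p C n x))"
    using equidist_card_children[OF p C] card_children_ge_1[OF C] by (intro sum_mono) auto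
  thus "card ?R * (if equidist p C n then p else 1) \<le> card (red C (p ^ Suc n))"
    unfolding card_red_Suc[OF C] by simp
  have "(\<Sum>x\<in>?R. card (children p C n x)) \<le> (\<Sum>x\<in>?R. (if branches p C n then p else 1))"
    using not_branches_card_children[OF C] card_children_le[OF p] by (intro sum_mono) auto
  thus "card (red C (p ^ Suc n)) \<le> card ?R * (if branches p C n then p else 1)"
    unfolding card_red_Suc[OF C] by simp
qed

lemma card_le_prime_power_branches:
  assumes p: "p > 0" and C: "C \<subseteq> {..<p ^ \<gamma>}"
  shows "card C \<le> p ^ card {n. n < \<gamma> \<and> branches p C n}"
proof -
  have fin: "finite C" using C finite_subset by blast
  have "card (red C (p ^ m)) \<le> (\<Prod>n<m. if branches p C n then p else 1)" for m
  proof (induction m)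
    case 0
    have "card (red C 1) \<le> 1" using red_1[of C] by (cases "C = {}") (simp_all add: red_def)
    thus ?case by simp
  next
    case (Suc m)
    have "card (red C (p ^ Suc m)) \<le> card (red C (p ^ m)) * (if branches p C m then p else 1)"
      by (rule card_red_Suc_bounds[OF p fin])
    also have "\<dots> \<le> (\<Prod>n<m. if branches p C n then p else 1) * (if branches p C m then p else 1)"
      using Suc by (rule mult_le_mono1)
    finally show ?case by simp
  qed
  from this[of \<gamma>] show ?thesis
    unfolding red_id[OF C] prod.inter_filter[symmetric, OF finite_lessThan] by (simp add: lessThan_def)
qed

text \<open>The starting level \<open>m\<close> is arbitrary because the cardinality criterion for
  homogeneity cancels the factor of the levels from \<open>m\<close> on.\<close>

lemma card_red_ge_prod:
  assumes p: "p > 0" and C: "finite C" and "m \<le> k"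
  shows "card (red C (p ^ m)) * (\<Prod>n\<in>{m..<k}. if equidist p C n then p else 1) \<le> card (red C (p ^ k))"
  using \<open>m \<le> k\<close>
proof (induction rule: dec_induct)
  case (step k)
  have "card (red C (p ^ m)) * (\<Prod>n\<in>{m..<Suc k}. if equidist p C n then p else 1)
     = (card (red C (p ^ m)) * (\<Prod>n\<in>{m..<k}. if equidist p C n then p else 1))
        * (if equidist p C k then p else 1)"
    using step.hyps by simp
  also have "\<dots> \<le> card (red C (p ^ k)) * (if equidist p C k then p else 1)"
    using step.IH by (rule mult_le_mono1)
  also have "\<dots> \<le> card (red C (p ^ Suc k))"
    by (rule card_red_Suc_bounds[OF p C])
  finally show ?case .
qed simp

lemma prod_if_equidist:
  "(\<Prod>n<m. if equidist p C n then p else 1) = p ^ card {n. n < m \<and> equidist p C n}"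
  unfolding prod.inter_filter[symmetric, OF finite_lessThan] by (simp add: lessThan_def)

lemma card_red_ge_prime_power_equidist:
  assumes p: "p > 0" and C: "finite C" "C \<noteq> {}"
  shows "p ^ card {n. n < m \<and> equidist p C n} \<le> card (red C (p ^ m))"
  using card_red_ge_prod[OF p C(1), of 0 m] prod_if_equidist[of p C m]
  by (simp add: red_1[OF C(2), simplified] atLeast0LessThan)

text \<open>Consecutive level sizes have a ratio between 1 and \<open>p\<close>. If both are powers
  of \<open>p\<close>, the ratio is one of these extremes, and a sum attaining a termwise bound
  attains it in every term.\<close>

lemma p_homogeneous_iff_card_red:
  assumes p: "p > 1" and C: "finite C" "C \<noteq> {}"
  shows "p_homogeneous p \<gamma> C \<longleftrightarrow> (\<forall>i\<in>{1..\<gamma>}. \<exists>k. card (red C (p ^ i)) = p ^ k)"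
proof
  have p0: "p > 0" using p by simp
  {
    assume hom: "p_homogeneous p \<gamma> C"
    have "\<exists>k. card (red C (p ^ i)) = p ^ k" if "i \<le> \<gamma>" for i
      using that
    proof (induction i)
      case 0
      show ?case using red_1[OF C(2)] by (intro exI[of _ 0]) simp
    next
      case (Suc i)
      then obtain k where k: "card (red C (p ^ i)) = p ^ k" by auto
      from hom Suc.prems consider "\<forall>x\<in>red C (p ^ i). card (children p C i x) = 1"
        | "\<forall>x\<in>red C (p ^ i). card (children p C i x) = p"
        unfolding p_homogeneous_children by (meson Suc_le_eq)
      thus ?case
      proof cases
        case 1
        thus ?thesis unfolding card_red_Suc[OF C(1)] using k by auto
      next
        case 2
        hence "card (red C (p ^ Suc i)) = p ^ Suc k" unfolding card_red_Suc[OF C(1)] using k by simp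
        thus ?thesis by blast
      qed
    qed
    thus "\<forall>i\<in>{1..\<gamma>}. \<exists>k. card (red C (p ^ i)) = p ^ k" by simp
  }
  assume pow: "\<forall>i\<in>{1..\<gamma>}. \<exists>k. card (red C (p ^ i)) = p ^ k"
  \<comment> \<open>Level 0 is added to the range: it consists of a single vertex, giving
    \<open>p ^ 0\<close>.\<close>
  have pow: "\<exists>k. card (red C (p ^ i)) = p ^ k" if "i \<le> \<gamma>" for i
    using pow that red_1[OF C(2)] by (cases "i = 0") (auto intro: exI[of _ 0])
  show "p_homogeneous p \<gamma> C"
    unfolding p_homogeneous_children
  proof (intro allI impI)
    fix n assume n: "n < \<gamma>"
    let ?R = "red C (p ^ n)"
    obtain k k' where k: "card ?R = p ^ k" "card (red C (p ^ Suc n)) = p ^ k'"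
      using pow[of n] pow[of "Suc n"] n by auto
    have fin: "finite ?R" using finite_red[OF C(1)] .
    have s: "(\<Sum>x\<in>?R. card (children p C n x)) = p ^ k'" using card_red_Suc[OF C(1)] k by simp
    have "(\<Sum>x\<in>?R. 1) \<le> (\<Sum>x\<in>?R. card (children p C n x))"
      using card_children_ge_1[OF C(1)] by (intro sum_mono) auto
    hence "p ^ k \<le> p ^ k'" using s k by simp
    hence le1: "k \<le> k'" using p by simp
    have "(\<Sum>x\<in>?R. card (children p C n x)) \<le> (\<Sum>x\<in>?R. p)"
      using card_children_le[OF p0] by (intro sum_mono) auto
    hence "p ^ k' \<le> p ^ Suc k" using s k by (simp add: mult.commute)
    hence le2: "k' \<le> Suc k" using p power_increasing_iff by blast
    consider "k' = k" | "k' = Suc k" using le1 le2 by linarith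
    thus "(\<forall>x\<in>?R. card (children p C n x) = 1) \<or> (\<forall>x\<in>?R. card (children p C n x) = p)"
    proof cases
      case 1
      hence eq: "(\<Sum>x\<in>?R. 1) = (\<Sum>x\<in>?R. card (children p C n x))" using s k by simp
      have "1 = card (children p C n x)" if "x \<in> ?R" for x
        by (rule sum_mono_inv[OF eq card_children_ge_1[OF C(1)] that fin])
      thus ?thesis by simp
    next
      case 2
      hence eq: "(\<Sum>x\<in>?R. card (children p C n x)) = (\<Sum>x\<in>?R. p)" using s k by simp
      have "card (children p C n x) = p" if "x \<in> ?R" for x
        by (rule sum_mono_inv[OF eq card_children_le[OF p0] that fin])
      thus ?thesis by simp
    qed
  qed
qed

text \<open>The reverse inequality always holds, so the bound expresses that no level has slack. The
  Fourier, tiling and spectral conditions are all reduced to this criterion.\<close>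

lemma p_homogeneous_iff_card_le:
  assumes p: "p > 1" and C: "C \<subseteq> {..<p ^ \<gamma>}" "C \<noteq> {}"
  shows "p_homogeneous p \<gamma> C \<longleftrightarrow> card C \<le> p ^ card {n. n < \<gamma> \<and> equidist p C n}"
proof
  have fin: "finite C" using C finite_subset by blast
  have p0: "p > 0" using p by simp
  let ?w = "\<lambda>n. if equidist p C n then p else 1"
  {
    assume "p_homogeneous p \<gamma> C"
    hence "{n. n < \<gamma> \<and> branches p C n} = {n. n < \<gamma> \<and> equidist p C n}"
      using p_homogeneous_iff_branches[OF p0 C(1)] equidist_imp_branches[OF p fin C(2)] by blast
    thus "card C \<le> p ^ card {n. n < \<gamma> \<and> equidist p C n}"
      using card_le_prime_power_branches[OF p0 C(1)] by simp
  }
  assume le: "card C \<le> p ^ card {n. n < \<gamma> \<and> equidist p C n}"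
  have "card (red C (p ^ m)) = p ^ card {n. n < m \<and> equidist p C n}" if m: "m \<le> \<gamma>" for m
  proof -
    \<comment> \<open>The factor of the levels from \<open>m\<close> on occurs on both sides and
      cancels, leaving the upper bound at level \<open>m\<close>.\<close>
    have pos: "prod ?w {m..<\<gamma>} > 0" using p0 by (intro prod_pos) simp
    have "card (red C (p ^ m)) * prod ?w {m..<\<gamma>} \<le> card C"
      using card_red_ge_prod[OF p0 fin m] red_id[OF C(1)] by simp
    also have "\<dots> \<le> prod ?w {..<\<gamma>}" using le by (simp only: prod_if_equidist)
    also have "{..<\<gamma>} = {..<m} \<union> {m..<\<gamma>}" using m by auto
    also have "prod ?w \<dots> = prod ?w {..<m} * prod ?w {m..<\<gamma>}" by (rule prod.union_disjoint) auto
    finally have "card (red C (p ^ m)) \<le> p ^ card {n. n < m \<and> equidist p C n}"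
      using pos by (simp only: prod_if_equidist mult_le_cancel2)
    thus ?thesis using card_red_ge_prime_power_equidist[OF p0 fin C(2), of m] by (rule antisym)
  qed
  thus "p_homogeneous p \<gamma> C" unfolding p_homogeneous_iff_card_red[OF p fin C(2)] by auto
qed

lemma p_homogeneous_card:
  assumes p: "p > 1" and C: "C \<subseteq> {..<p ^ \<gamma>}" "C \<noteq> {}" and hom: "p_homogeneous p \<gamma> C"
  shows "card C = p ^ card {n. n < \<gamma> \<and> equidist p C n}"
  using p_homogeneous_iff_card_le[OF p C] hom card_red_ge_prime_power_equidist[of p C \<gamma>] p C
    red_id[OF C(1)] finite_subset[OF C(1)] by (intro antisym) auto

subsection \<open>Sets with prescribed free digits\<close>

lemma nat_mod_eq_iff_int_dvd: "x mod m = y mod m \<longleftrightarrow> int m dvd int x - int y" for x y m :: nat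
  by (metis mod_eq_dvd_iff zmod_int of_nat_eq_iff)

text \<open>Otherwise the residues would agree inductively up to level \<open>\<gamma>\<close>. The
  level found is a branching level of every set containing both points.\<close>

lemma first_differing_digit:
  fixes x y :: nat
  assumes "x < p ^ \<gamma>" "y < p ^ \<gamma>" "x \<noteq> y"
  shows "\<exists>n<\<gamma>. x mod p ^ n = y mod p ^ n \<and> x mod p ^ Suc n \<noteq> y mod p ^ Suc n"
proof (rule ccontr)
  assume *: "\<not> ?thesis"
  have "m \<le> \<gamma> \<longrightarrow> x mod p ^ m = y mod p ^ m" for m
  proof (induction m)
    case (Suc m)
    thus ?case using * by auto
  qed simp
  from this[of \<gamma>] show False using assms by simp
qed

text \<open>The first differing digit is the \<open>p\<close>-adic valuation of the difference,
  which is the form needed for character sums.\<close>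

lemma differing_digit_factor:
  fixes x y :: nat
  assumes "x mod p ^ n = y mod p ^ n" "x mod p ^ Suc n \<noteq> y mod p ^ Suc n"
  obtains u where "int x - int y = int p ^ n * u" "\<not> int p dvd u"
proof -
  from assms(1) obtain u where u: "int x - int y = int p ^ n * u"
    unfolding nat_mod_eq_iff_int_dvd by (auto elim: dvdE)
  have "\<not> int p dvd u"
  proof
    assume "int p dvd u"
    hence "int p ^ n * int p dvd int x - int y" unfolding u by (rule mult_dvd_mono[OF dvd_refl])
    thus False using assms(2) unfolding nat_mod_eq_iff_int_dvd by (simp add: mult.commute)
  qed
  with u show thesis by (rule that)
qed

text \<open>Positions in \<open>J\<close> carry free digits, the others carry 0. Each recursion step
  prepends the most significant digit, so reduction modulo \<open>p ^ i\<close> just stops the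
  recursion at \<open>i\<close>.\<close>

fun digit_set :: "nat \<Rightarrow> nat set \<Rightarrow> nat \<Rightarrow> nat set" where
  "digit_set p J 0 = {0}"
| "digit_set p J (Suc n) =
     (\<lambda>(d, x). d * p ^ n + x) ` ((if n \<in> J then {..<p} else {0}) \<times> digit_set p J n)"

lemma digit_set_subset: "p > 0 \<Longrightarrow> digit_set p J m \<subseteq> {..<p ^ m}"
proof (induction m)
  case (Suc m)
  have "d * p ^ m + x < p ^ Suc m" if "d < p" "x \<in> digit_set p J m" for d x
  proof -
    have "d * p ^ m + x < Suc d * p ^ m" using Suc that by auto
    also have "\<dots> \<le> p * p ^ m" using that by (intro mult_le_mono1) simp
    finally show ?thesis by simp
  qed
  thus ?case using Suc.prems by (auto split: if_splits)
qed simp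

lemma card_digit_set:
  assumes "p > 0"
  shows "card (digit_set p J m) = p ^ card {n. n < m \<and> n \<in> J}"
proof (induction m)
  case (Suc m)
  let ?A = "if m \<in> J then {..<p} else {0}"
  have "inj_on (\<lambda>(d, x). d * p ^ m + x) (?A \<times> digit_set p J m)"
  proof (rule inj_onI, clarify)
    fix d x d' x'
    assume x: "x \<in> digit_set p J m" "x' \<in> digit_set p J m" and eq: "d * p ^ m + x = d' * p ^ m + x'"
    have lt: "x < p ^ m" "x' < p ^ m" using x digit_set_subset[OF assms] by auto
    have "x = x'" using arg_cong[OF eq, of "\<lambda>t. t mod p ^ m"] lt by simp
    moreover have "d = d'" using arg_cong[OF eq, of "\<lambda>t. t div p ^ m"] lt assms by simp
    ultimately show "d = d' \<and> x = x'" by simp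
  qed
  hence "card (digit_set p J (Suc m)) = card ?A * p ^ card {n. n < m \<and> n \<in> J}"
    using Suc by (simp only: digit_set.simps card_image card_cartesian_product)
  also have "{n. n < Suc m \<and> n \<in> J} = (if m \<in> J then insert m else id) {n. n < m \<and> n \<in> J}"
    by (auto simp: less_Suc_eq)
  ultimately show ?case by simp
qed simp

lemma digit_set_nonempty: "p > 0 \<Longrightarrow> digit_set p J m \<noteq> {}"
  using card_digit_set[of p J m] by auto

lemma red_digit_set:
  assumes p: "p > 0" and "i \<le> m"
  shows "red (digit_set p J m) (p ^ i) = digit_set p J i"
  using \<open>i \<le> m\<close>
proof (induction m)
  case 0
  thus ?case by (simp add: red_def)
next
  case (Suc m)
  show ?case
  proof (cases "i = Suc m")
    case True
    thus ?thesis using digit_set_subset[OF p] by (simp only: red_id)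
  next
    case False
    hence i: "i \<le> m" using Suc.prems by simp
    have mod: "(d * p ^ m + x) mod p ^ i = x mod p ^ i" for d x
    proof -
      have "p ^ i dvd d * p ^ m" using i by (simp add: le_imp_power_dvd)
      then obtain k where "d * p ^ m = p ^ i * k" by (elim dvdE)
      thus ?thesis by simp
    qed
    let ?A = "if m \<in> J then {..<p} else {0}"
    have "red (digit_set p J (Suc m)) (p ^ i) = (\<lambda>t. snd t mod p ^ i) ` (?A \<times> digit_set p J m)"
      by (simp only: red_def digit_set.simps image_image case_prod_beta mod)
    also have "\<dots> = (\<lambda>x. x mod p ^ i) ` (snd ` (?A \<times> digit_set p J m))"
      by (simp only: image_image)
    also have "\<dots> = red (digit_set p J m) (p ^ i)"
      using p by (auto simp: snd_image_times red_def)
    finally have "red (digit_set p J (Suc m)) (p ^ i) = red (digit_set p J m) (p ^ i)" .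
    thus ?thesis using Suc.IH[OF i] by simp
  qed
qed

lemma branches_digit_set:
  assumes p: "p > 0" and n: "n < m" and br: "branches p (digit_set p J m) n"
  shows "n \<in> J"
proof (rule ccontr)
  assume nJ: "n \<notin> J"
  \<comment> \<open>Digit \<open>n\<close> is 0 throughout, so reducing modulo
    \<open>p ^ Suc n\<close> retains nothing beyond the residue modulo \<open>p ^ n\<close>.\<close>
  have *: "x mod p ^ Suc n = x mod p ^ n" if "x \<in> digit_set p J m" for x
  proof -
    have "x mod p ^ Suc n \<in> red (digit_set p J m) (p ^ Suc n)" using that by (auto simp: red_def)
    also have "\<dots> = digit_set p J (Suc n)" using n by (intro red_digit_set[OF p]) simp
    also have "\<dots> = digit_set p J n" using nJ by (auto simp: image_iff)
    finally have "x mod p ^ Suc n < p ^ n" using digit_set_subset[OF p] by auto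
    hence "x mod p ^ Suc n = (x mod p ^ Suc n) mod p ^ n" by simp
    also have "\<dots> = x mod p ^ n" by (simp add: mod_mod_cancel)
    finally show ?thesis .
  qed
  thus False using br unfolding branches_def by metis
qed

text \<open>All reductions have prime power size, so the set is homogeneous and has as many
  equidistributed levels as free positions. These levels branch and hence lie in \<open>J\<close>;
  equal cardinalities turn the inclusion into equality.\<close>

lemma equidist_digit_set_iff:
  assumes p: "p > 1" and n: "n < m"
  shows "equidist p (digit_set p J m) n \<longleftrightarrow> n \<in> J"
proof -
  let ?D = "digit_set p J m"
  have p0: "p > 0" using p by simp
  note sub = digit_set_subset[OF p0, of J m]
  have fin: "finite ?D" using sub finite_subset by blast
  note ne = digit_set_nonempty[OF p0, of J m]
  have "p_homogeneous p m ?D"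
    unfolding p_homogeneous_iff_card_red[OF p fin ne] using red_digit_set[OF p0] card_digit_set[OF p0] by auto
  hence "card ?D = p ^ card {n. n < m \<and> equidist p ?D n}"
    by (rule p_homogeneous_card[OF p sub ne])
  hence "p ^ card {n. n < m \<and> equidist p ?D n} = p ^ card {n. n < m \<and> n \<in> J}"
    by (simp only: card_digit_set[OF p0])
  hence "card {n. n < m \<and> equidist p ?D n} = card {n. n < m \<and> n \<in> J}"
    using p by (simp only: power_inject_exp)
  moreover have "{n. n < m \<and> equidist p ?D n} \<subseteq> {n. n < m \<and> n \<in> J}"
    using equidist_imp_branches[OF p fin ne] branches_digit_set[OF p0] by blast
  ultimately have "{n. n < m \<and> equidist p ?D n} = {n. n < m \<and> n \<in> J}"
    by (intro card_subset_eq) auto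
  thus ?thesis using n by blast
qed

subsection \<open>Tilings\<close>

lemma bij_betw_iff_ex1:
  assumes "f ` A \<subseteq> B"
  shows "bij_betw f A B \<longleftrightarrow> (\<forall>z\<in>B. \<exists>!a. a \<in> A \<and> f a = z)"
proof
  assume "bij_betw f A B"
  thus "\<forall>z\<in>B. \<exists>!a. a \<in> A \<and> f a = z"
    unfolding bij_betw_def inj_on_def by blast
next
  assume *: "\<forall>z\<in>B. \<exists>!a. a \<in> A \<and> f a = z"
  have "inj_on f A"
  proof (rule inj_onI)
    fix a b assume ab: "a \<in> A" "b \<in> A" "f a = f b"
    hence "f b \<in> B" using assms by blast
    thus "a = b" using * ab by blast
  qed
  moreover have "B \<subseteq> f ` A" using * by blast
  ultimately show "bij_betw f A B" using assms by (simp add: bij_betw_def subset_antisym)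
qed

lemma tiles_iff_bij_betw:
  assumes "p > 0"
  shows "tiles p \<gamma> C \<longleftrightarrow>
    (\<exists>S. S \<subseteq> {..<p ^ \<gamma>} \<and> bij_betw (\<lambda>(c, s). (c + s) mod p ^ \<gamma>) (C \<times> S) {..<p ^ \<gamma>})"
proof -
  have "bij_betw (\<lambda>(c, s). (c + s) mod p ^ \<gamma>) (C \<times> S) {..<p ^ \<gamma>} \<longleftrightarrow>
    (\<forall>z<p ^ \<gamma>. \<exists>!cs. fst cs \<in> C \<and> snd cs \<in> S \<and> (fst cs + snd cs) mod p ^ \<gamma> = z)" for S
  proof -
    have "(\<lambda>(c, s). (c + s) mod p ^ \<gamma>) ` (C \<times> S) \<subseteq> {..<p ^ \<gamma>}" using assms by auto
    from bij_betw_iff_ex1[OF this] show ?thesis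
      by (simp only: mem_Times_iff case_prod_beta conj_assoc lessThan_iff Ball_def)
  qed
  thus ?thesis by (simp only: tiles_def)
qed

text \<open>The sums over \<open>C\<close> and \<open>S\<close> multiply to the sum of
  \<open>z ^ w\<close> over all residues, a vanishing geometric sum, so one factor is 0.\<close>

lemma tiles_imp_equidist:
  assumes p: "prime p" and n: "n < \<gamma>" and fin: "finite C" "finite S"
    and bij: "bij_betw (\<lambda>(c, s). (c + s) mod p ^ \<gamma>) (C \<times> S) {..<p ^ \<gamma>}"
  shows "equidist p C n \<or> equidist p S n"
proof -
  define z where "z = cis (2 * pi * of_int 1 / real (p ^ Suc n))"
  have p0: "p > 0" using p by (rule prime_gt_0_nat)
  have "z ^ (p ^ n) = cis (2 * pi * of_int 1 / real p)" using p0 by (simp add: z_def DeMoivre)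
  hence z1: "z ^ (p ^ n) \<noteq> 1" using cis_2pi_frac_eq_1_iff[OF p0, of 1] prime_gt_1_nat[OF p] by simp
  have z2: "z ^ (p ^ Suc n) = 1" using p0 by (simp add: z_def DeMoivre)
  \<comment> \<open>The order of \<open>z\<close> divides \<open>p ^ \<gamma>\<close>, so reducing
    an exponent modulo \<open>p ^ \<gamma>\<close> is harmless.\<close>
  have "p ^ \<gamma> = p ^ Suc n * p ^ (\<gamma> - Suc n)" using n by (simp flip: power_add power_Suc)
  hence z\<gamma>: "z ^ (p ^ \<gamma>) = 1" by (simp only: power_mult z2 power_one)
  have zmod: "z ^ (x mod p ^ \<gamma>) = z ^ x" for x
  proof -
    have "z ^ x = z ^ (p ^ \<gamma> * (x div p ^ \<gamma>) + x mod p ^ \<gamma>)" by simp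
    also have "\<dots> = z ^ (x mod p ^ \<gamma>)" by (simp only: power_add power_mult z\<gamma> power_one mult_1)
    finally show ?thesis by simp
  qed
  have "z \<noteq> 1" using z1 by auto
  have "(\<Sum>c\<in>C. z ^ c) * (\<Sum>s\<in>S. z ^ s) = (\<Sum>(c, s)\<in>C \<times> S. z ^ ((c + s) mod p ^ \<gamma>))"
    by (simp add: sum_product sum.cartesian_product zmod power_add)
  also have "\<dots> = (\<Sum>w<p ^ \<gamma>. z ^ w)"
    using sum.reindex_bij_betw[OF bij, of "\<lambda>w. z ^ w"] by (simp add: case_prod_beta)
  also have "\<dots> = 0" using \<open>z \<noteq> 1\<close> z\<gamma> by (simp add: sum_gp_strict)
  finally show ?thesis
    using root_sum_zero_iff_equidist[OF p _ z1 z2] fin by simp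
qed

text \<open>The equidistributed levels of \<open>C\<close> and \<open>S\<close> cover all
  \<open>\<gamma>\<close> levels, while \<open>card C * card S = p ^ \<gamma>\<close>; the lower
  bound for \<open>card S\<close> becomes an upper bound for \<open>card C\<close>.\<close>

lemma tiles_imp_card_le:
  assumes p: "prime p" and C: "C \<subseteq> {..<p ^ \<gamma>}" "C \<noteq> {}" and "tiles p \<gamma> C"
  shows "card C \<le> p ^ card {n. n < \<gamma> \<and> equidist p C n}"
proof -
  have p0: "p > 0" using p by (rule prime_gt_0_nat)
  obtain S where S: "S \<subseteq> {..<p ^ \<gamma>}"
    and bij: "bij_betw (\<lambda>(c, s). (c + s) mod p ^ \<gamma>) (C \<times> S) {..<p ^ \<gamma>}"
    using assms(4) unfolding tiles_iff_bij_betw[OF p0] by blast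
  have fin: "finite C" "finite S" using C S finite_subset by blast+
  let ?E = "\<lambda>A. {n. n < \<gamma> \<and> equidist p A n}"
  have prod: "card C * card S = p ^ \<gamma>"
    using bij_betw_same_card[OF bij] by (simp add: card_cartesian_product)
  hence "S \<noteq> {}" using p0 by auto
  hence S_ge: "p ^ card (?E S) \<le> card S"
    using card_red_ge_prime_power_equidist[OF p0 fin(2), of \<gamma>] red_id[OF S] by simp
  have "{..<\<gamma>} \<subseteq> ?E C \<union> ?E S" using tiles_imp_equidist[OF p _ fin bij] by auto
  hence "card {..<\<gamma>} \<le> card (?E C \<union> ?E S)" by (intro card_mono) auto
  also have "\<dots> \<le> card (?E C) + card (?E S)" by (rule card_Un_le)
  finally have \<gamma>: "\<gamma> \<le> card (?E C) + card (?E S)" by simp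
  have "card C * p ^ card (?E S) \<le> p ^ \<gamma>" using S_ge prod by (metis mult_le_mono2)
  also have "\<dots> \<le> p ^ card (?E C) * p ^ card (?E S)"
    using \<gamma> p0 unfolding power_add[symmetric] by (intro power_increasing) auto
  finally show ?thesis using p0 by simp
qed

text \<open>Injectivity of addition on \<open>C \<times> S\<close>, together with
  \<open>card (C \<times> S) = p ^ \<gamma>\<close>, gives surjectivity.\<close>

lemma p_homogeneous_imp_tiles:
  assumes p: "p > 1" and C: "C \<subseteq> {..<p ^ \<gamma>}" "C \<noteq> {}" and hom: "p_homogeneous p \<gamma> C"
  shows "tiles p \<gamma> C"
proof -
  have p0: "p > 0" using p by simp
  \<comment> \<open>The complement is free exactly at the levels where \<open>C\<close> is not
    equidistributed, so no level branches for both sets.\<close>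
  define S where "S = digit_set p {n. \<not> equidist p C n} \<gamma>"
  have S: "S \<subseteq> {..<p ^ \<gamma>}" unfolding S_def by (rule digit_set_subset[OF p0])
  have inj: "inj_on (\<lambda>(c, s). (c + s) mod p ^ \<gamma>) (C \<times> S)"
  proof (rule inj_onI, clarify)
    fix c s c' s'
    assume *: "c \<in> C" "s \<in> S" "c' \<in> C" "s' \<in> S" "(c + s) mod p ^ \<gamma> = (c' + s') mod p ^ \<gamma>"
    have lt: "c < p ^ \<gamma>" "c' < p ^ \<gamma>" "s < p ^ \<gamma>" "s' < p ^ \<gamma>" using * C S by auto
    \<comment> \<open>Equal sums make \<open>c - c'\<close> and \<open>s - s'\<close> opposite
      modulo \<open>p ^ \<gamma>\<close>, so the two pairs first differ at the same level.\<close>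
    have iff: "c mod p ^ m = c' mod p ^ m \<longleftrightarrow> s mod p ^ m = s' mod p ^ m" if "m \<le> \<gamma>" for m
    proof -
      have "int (p ^ m) dvd int (p ^ \<gamma>)" using that by (simp add: le_imp_power_dvd)
      also have "\<dots> dvd int (c + s) - int (c' + s')" using *(5) unfolding nat_mod_eq_iff_int_dvd .
      finally have d: "int (p ^ m) dvd (int c - int c') + (int s - int s')" by (simp add: algebra_simps)
      show ?thesis unfolding nat_mod_eq_iff_int_dvd
        using dvd_add_right_iff[of "int (p ^ m)" "int c - int c'" "int s - int s'"]
          dvd_add_left_iff[of "int (p ^ m)" "int s - int s'" "int c - int c'"] d by blast
    qed
    have "c = c'"
    proof (rule ccontr)
      assume "c \<noteq> c'"
      then obtain n where n: "n < \<gamma>" "c mod p ^ n = c' mod p ^ n" "c mod p ^ Suc n \<noteq> c' mod p ^ Suc n"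
        using first_differing_digit[OF lt(1,2)] by blast
      have "branches p C n" using n * unfolding branches_def by blast
      hence "equidist p C n" using hom n unfolding p_homogeneous_iff_branches[OF p0 C(1)] by blast
      moreover have "s mod p ^ n = s' mod p ^ n" "s mod p ^ Suc n \<noteq> s' mod p ^ Suc n"
        using n iff[of n] iff[of "Suc n"] by auto
      hence "branches p S n" using * unfolding branches_def by blast
      hence "\<not> equidist p C n" using branches_digit_set[OF p0 n(1)] unfolding S_def by blast
      ultimately show False by blast
    qed
    moreover have "s = s'" using iff[of \<gamma>] \<open>c = c'\<close> lt by simp
    ultimately show "c = c' \<and> s = s'" by blast
  qed
  have "{..<\<gamma>} = {n. n < \<gamma> \<and> equidist p C n} \<union> {n. n < \<gamma> \<and> \<not> equidist p C n}" by auto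
  hence "card {..<\<gamma>} = card {n. n < \<gamma> \<and> equidist p C n} + card {n. n < \<gamma> \<and> \<not> equidist p C n}"
    by (simp only:) (rule card_Un_disjoint, auto)
  hence "card (C \<times> S) = p ^ \<gamma>"
    using p_homogeneous_card[OF p C hom] card_digit_set[OF p0, of "{n. \<not> equidist p C n}" \<gamma>]
    by (simp add: card_cartesian_product S_def flip: power_add)
  hence "(\<lambda>(c, s). (c + s) mod p ^ \<gamma>) ` (C \<times> S) = {..<p ^ \<gamma>}"
    using p0 card_image[OF inj] by (intro card_subset_eq) auto
  thus ?thesis unfolding tiles_iff_bij_betw[OF p0] using S inj by (auto simp: bij_betw_def)
qed

subsection \<open>Spectra\<close>

lemma card_reflect: "card {l. l < m \<and> P (m - 1 - l)} = card {n. n < m \<and> P n}" for m :: nat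
  by (rule bij_betw_same_card[of "\<lambda>l. m - 1 - l"], rule bij_betw_byWitness[of _ "\<lambda>l. m - 1 - l"]) auto

lemma expo_commute: "expo p \<gamma> k x = expo p \<gamma> x k"
  by (simp add: expo_def mult_ac)

lemma expo_mult_cnj:
  "expo p \<gamma> k x * cnj (expo p \<gamma> k' x) = cis (2 * pi * of_int (int k - int k') * real x / real (p ^ \<gamma>))"
  by (simp add: expo_def cis_cnj cis_mult diff_divide_distrib algebra_simps)

lemma expo_mult_cnj_self: "expo p \<gamma> k x * cnj (expo p \<gamma> k x) = 1"
  by (simp add: expo_mult_cnj)

text \<open>Only the first differing digit of the two frequencies matters, and it selects the
  reflected level of \<open>C\<close>.\<close>

lemma expo_orthogonal_iff:
  assumes p: "prime p" and C: "finite C" and l: "l < \<gamma>"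
    and k: "k mod p ^ l = k' mod p ^ l" "k mod p ^ Suc l \<noteq> k' mod p ^ Suc l"
  shows "(\<Sum>x\<in>C. expo p \<gamma> k x * cnj (expo p \<gamma> k' x)) = 0 \<longleftrightarrow> equidist p C (\<gamma> - 1 - l)"
proof -
  obtain u where u: "int k - int k' = int p ^ l * u" "\<not> int p dvd u"
    using differing_digit_factor[OF k] by blast
  show ?thesis
    unfolding expo_mult_cnj u(1) by (rule character_sum_zero_iff_equidist[OF p C u(2) l])
qed

lemma p_homogeneous_imp_spectral:
  assumes p: "prime p" and C: "C \<subseteq> {..<p ^ \<gamma>}" "C \<noteq> {}" and hom: "p_homogeneous p \<gamma> C"
  shows "spectral p \<gamma> C"
proof -
  have p1: "p > 1" using p by (rule prime_gt_1_nat)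
  hence p0: "p > 0" by simp
  \<comment> \<open>Frequencies read the levels in reverse order, so the free digits of the spectrum
    are the reflected equidistributed levels.\<close>
  define J where "J = {l. equidist p C (\<gamma> - 1 - l)}"
  define L where "L = digit_set p J \<gamma>"
  have L: "L \<subseteq> {..<p ^ \<gamma>}" unfolding L_def by (rule digit_set_subset[OF p0])
  have fin: "finite C" "finite L" using C L finite_subset by blast+
  have L0: "card L \<noteq> 0" using fin digit_set_nonempty[OF p0] unfolding L_def by simp
  have orth: "(\<Sum>x\<in>C. expo p \<gamma> k x * cnj (expo p \<gamma> k' x)) = 0"
    if k: "k \<in> L" "k' \<in> L" "k \<noteq> k'" for k k'
  proof -
    obtain l where l: "l < \<gamma>" "k mod p ^ l = k' mod p ^ l" "k mod p ^ Suc l \<noteq> k' mod p ^ Suc l"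
      using first_differing_digit[of k p \<gamma> k'] k L by blast
    hence "branches p L l" using k unfolding branches_def by blast
    hence "l \<in> J" using branches_digit_set[OF p0 l(1)] unfolding L_def by blast
    thus ?thesis using expo_orthogonal_iff[OF p fin(1) l] by (simp add: J_def)
  qed
  \<comment> \<open>Orthogonality in the other variable yields the expansion explicitly, without a dimension count.\<close>
  have dual: "(\<Sum>k\<in>L. expo p \<gamma> k x * cnj (expo p \<gamma> k y)) = (if x = y then of_nat (card L) else 0)"
    if xy: "x \<in> C" "y \<in> C" for x y
  proof (cases "x = y")
    case True
    thus ?thesis by (simp add: expo_mult_cnj_self)
  next
    case False
    obtain n where n: "n < \<gamma>" "x mod p ^ n = y mod p ^ n" "x mod p ^ Suc n \<noteq> y mod p ^ Suc n"
      using first_differing_digit[of x p \<gamma> y] xy False C by blast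
    hence "branches p C n" using xy unfolding branches_def by blast
    hence "equidist p C n" using hom n unfolding p_homogeneous_iff_branches[OF p0 C(1)] by blast
    \<comment> \<open>Since \<open>n < \<gamma>\<close>, the truncated subtraction is exact and
      reflecting twice returns \<open>n\<close>.\<close>
    hence "\<gamma> - 1 - n \<in> J" using n by (simp add: J_def)
    hence "equidist p L (\<gamma> - 1 - n)"
      unfolding L_def using equidist_digit_set_iff[OF p1, of "\<gamma> - 1 - n" \<gamma> J] n by simp
    hence "(\<Sum>k\<in>L. expo p \<gamma> x k * cnj (expo p \<gamma> y k)) = 0"
      using expo_orthogonal_iff[OF p fin(2) n] by simp
    thus ?thesis using False by (simp add: expo_commute[of p \<gamma> x] expo_commute[of p \<gamma> y])
  qed
  \<comment> \<open>The witness is the Fourier coefficient of \<open>f\<close> on \<open>C\<close>,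
    normalised by \<open>card L\<close> because the dual relation sums over
    \<open>L\<close>.\<close>
  have span: "\<exists>a. \<forall>x\<in>C. f x = (\<Sum>k\<in>L. a k * expo p \<gamma> k x)" for f :: "nat \<Rightarrow> complex"
  proof (intro exI ballI)
    fix x assume x: "x \<in> C"
    have "(\<Sum>k\<in>L. ((\<Sum>y\<in>C. f y * cnj (expo p \<gamma> k y)) / of_nat (card L)) * expo p \<gamma> k x)
      = (\<Sum>k\<in>L. \<Sum>y\<in>C. f y * (expo p \<gamma> k x * cnj (expo p \<gamma> k y))) / of_nat (card L)"
      by (simp add: sum_divide_distrib sum_distrib_left sum_distrib_right mult_ac)
    also have "(\<Sum>k\<in>L. \<Sum>y\<in>C. f y * (expo p \<gamma> k x * cnj (expo p \<gamma> k y)))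
      = (\<Sum>y\<in>C. f y * (\<Sum>k\<in>L. expo p \<gamma> k x * cnj (expo p \<gamma> k y)))"
      by (subst sum.swap) (simp add: sum_distrib_left)
    also have "\<dots> = (\<Sum>y\<in>C. if x = y then f y * of_nat (card L) else 0)"
      using dual[OF x] by (intro sum.cong) auto
    also have "\<dots> = f x * of_nat (card L)" using x fin by simp
    finally show "f x = (\<Sum>k\<in>L. ((\<Sum>y\<in>C. f y * cnj (expo p \<gamma> k y)) / of_nat (card L)) * expo p \<gamma> k x)"
      using L0 by simp
  qed
  show ?thesis
    unfolding spectral_def by (intro exI[of _ L] conjI ballI impI allI L orth span)
qed

text \<open>In the expansion of the point mass at \<open>x\<^sub>0\<close>, orthogonality determines
  each coefficient as a conjugate character value divided by \<open>card C\<close>. Evaluation at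
  \<open>x\<^sub>0\<close> then reads \<open>1 = card L / card C\<close>.\<close>

lemma spectrum_card:
  assumes C: "finite C" "C \<noteq> {}"
    and L: "finite L"
    and orth: "\<And>k k'. k \<in> L \<Longrightarrow> k' \<in> L \<Longrightarrow> k \<noteq> k' \<Longrightarrow>
        (\<Sum>x\<in>C. expo p \<gamma> k x * cnj (expo p \<gamma> k' x)) = 0"
    and span: "\<And>f :: nat \<Rightarrow> complex. \<exists>a. \<forall>x\<in>C. f x = (\<Sum>k\<in>L. a k * expo p \<gamma> k x)"
  shows "card L = card C"
proof -
  obtain x\<^sub>0 where x\<^sub>0: "x\<^sub>0 \<in> C" using C by blast
  let ?e = "expo p \<gamma>"
  obtain a where a: "\<And>x. x \<in> C \<Longrightarrow> (if x = x\<^sub>0 then 1 else 0) = (\<Sum>k\<in>L. a k * ?e k x)"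
    using span[of "\<lambda>x. if x = x\<^sub>0 then 1 else 0"] by blast
  have coeff: "a k * of_nat (card C) = cnj (?e k x\<^sub>0)" if k: "k \<in> L" for k
  proof -
    have "cnj (?e k x\<^sub>0) = (\<Sum>x\<in>C. (if x = x\<^sub>0 then 1 else 0) * cnj (?e k x))"
      using x\<^sub>0 C by (simp add: if_distrib[of "\<lambda>t. t * _"] cong: if_cong)
    also have "\<dots> = (\<Sum>x\<in>C. (\<Sum>k'\<in>L. a k' * ?e k' x) * cnj (?e k x))"
      using a by (intro sum.cong) auto
    also have "\<dots> = (\<Sum>k'\<in>L. a k' * (\<Sum>x\<in>C. ?e k' x * cnj (?e k x)))"
      unfolding sum_distrib_right by (subst sum.swap) (simp add: sum_distrib_left mult.assoc)
    also have "\<dots> = (\<Sum>k'\<in>L. if k' = k then a k * of_nat (card C) else 0)"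
      using orth k by (intro sum.cong) (auto simp: expo_mult_cnj_self)
    also have "\<dots> = a k * of_nat (card C)" using k L by simp
    finally show ?thesis ..
  qed
  have "of_nat (card C) = (\<Sum>k\<in>L. a k * ?e k x\<^sub>0) * of_nat (card C)" using a[OF x\<^sub>0] by simp
  also have "\<dots> = (\<Sum>k\<in>L. ?e k x\<^sub>0 * cnj (?e k x\<^sub>0))"
    unfolding sum_distrib_right by (intro sum.cong refl) (simp add: coeff[symmetric] mult_ac)
  also have "\<dots> = of_nat (card L)" by (simp add: expo_mult_cnj_self)
  finally have "(of_nat (card C) :: complex) = of_nat (card L)" .
  thus ?thesis by (simp only: of_nat_eq_iff)
qed

text \<open>A branching level of \<open>L\<close> yields two orthogonal frequencies first differing
  there, hence an equidistributed level of \<open>C\<close>. Thus the upper bound for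
  \<open>card L\<close> by its branching levels bounds \<open>card C\<close>.\<close>

lemma spectral_imp_card_le:
  assumes p: "prime p" and C: "C \<subseteq> {..<p ^ \<gamma>}" "C \<noteq> {}" and sp: "spectral p \<gamma> C"
  shows "card C \<le> p ^ card {n. n < \<gamma> \<and> equidist p C n}"
proof -
  have p0: "p > 0" using p by (rule prime_gt_0_nat)
  obtain L where L: "L \<subseteq> {..<p ^ \<gamma>}"
    and orth: "\<And>k k'. k \<in> L \<Longrightarrow> k' \<in> L \<Longrightarrow> k \<noteq> k' \<Longrightarrow>
        (\<Sum>x\<in>C. expo p \<gamma> k x * cnj (expo p \<gamma> k' x)) = 0"
    and span: "\<And>f :: nat \<Rightarrow> complex. \<exists>a. \<forall>x\<in>C. f x = (\<Sum>k\<in>L. a k * expo p \<gamma> k x)"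
    using sp unfolding spectral_def by blast
  have fin: "finite C" "finite L" using C L finite_subset by blast+
  have br: "equidist p C (\<gamma> - 1 - l)" if l: "l < \<gamma>" and brl: "branches p L l" for l
  proof -
    obtain k k' where k: "k \<in> L" "k' \<in> L" "k mod p ^ l = k' mod p ^ l" "k mod p ^ Suc l \<noteq> k' mod p ^ Suc l"
      using brl unfolding branches_def by blast
    hence "k \<noteq> k'" by blast
    thus ?thesis using expo_orthogonal_iff[OF p fin(1) l k(3,4)] orth k(1,2) by blast
  qed
  have "card C = card L" using spectrum_card[OF fin(1) C(2) fin(2) orth span] by simp
  also have "\<dots> \<le> p ^ card {l. l < \<gamma> \<and> branches p L l}" by (rule card_le_prime_power_branches[OF p0 L])
  also have "\<dots> \<le> p ^ card {l. l < \<gamma> \<and> equidist p C (\<gamma> - 1 - l)}"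
    using br p0 by (intro power_increasing card_mono) auto
  also have "\<dots> = p ^ card {n. n < \<gamma> \<and> equidist p C n}" by (simp only: card_reflect)
  finally show ?thesis .
qed

section \<open>Zeros of the Fourier transform and the equivalences\<close>

text \<open>For \<open>l < \<gamma>\<close> this is the character sum with cofactor
  \<open>-1\<close>. For \<open>l \<ge> \<gamma>\<close> the character is trivial and the transform
  equals the nonzero number \<open>card C\<close>, so large exponents yield no zeros.\<close>

lemma fourier_indicator_zero_iff:
  assumes p: "prime p" and C: "C \<subseteq> {..<p ^ \<gamma>}" "C \<noteq> {}"
  shows "fourier p \<gamma> (\<lambda>x. if x \<in> C then 1 else 0) (p ^ l) = 0 \<longleftrightarrow> l < \<gamma> \<and> equidist p C (\<gamma> - 1 - l)"
proof -
  have fin: "finite C" using C finite_subset by blast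
  have p0: "p > 0" using p by (rule prime_gt_0_nat)
  have "fourier p \<gamma> (\<lambda>x. if x \<in> C then 1 else 0) (p ^ l)
      = (\<Sum>x<p ^ \<gamma>. if x \<in> C then cis (2 * pi * of_int (int p ^ l * (-1)) * real x / real (p ^ \<gamma>)) else 0)"
    unfolding fourier_def by (intro sum.cong refl) (simp split: if_splits)
  also have "\<dots> = (\<Sum>x\<in>C. cis (2 * pi * of_int (int p ^ l * (-1)) * real x / real (p ^ \<gamma>)))"
    using C by (simp add: sum.inter_restrict[symmetric] Int_absorb1)
  finally have F: "fourier p \<gamma> (\<lambda>x. if x \<in> C then 1 else 0) (p ^ l) = \<dots>" .
  show ?thesis
  proof (cases "l < \<gamma>")
    case True
    have "\<not> int p dvd -1" using prime_gt_1_nat[OF p] by simp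
    from character_sum_zero_iff_equidist[OF p fin this True] show ?thesis using True F by simp
  next
    case False
    have "cis (2 * pi * of_int (int p ^ l * (-1)) * real x / real (p ^ \<gamma>)) = 1" for x
    proof -
      have "int (p ^ \<gamma>) dvd int p ^ l * (-1) * int x"
        using False by (simp add: le_imp_power_dvd)
      thus ?thesis using cis_2pi_frac_eq_1_iff[of "p ^ \<gamma>" "int p ^ l * (-1) * int x"] p0
        by (simp add: mult.assoc)
    qed
    thus ?thesis using False F fin C by simp
  qed
qed

theorem theorem1p3:
  fixes p \<gamma> :: nat and C :: "nat set"
  assumes "prime p" and "\<gamma> \<ge> 1"
    and "C \<subseteq> {..<p^\<gamma>}" and "C \<noteq> {}"
  defines "hat1C \<equiv> fourier p \<gamma> (\<lambda>x. if x \<in> C then 1 else 0)"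
  shows "(p_homogeneous p \<gamma> C \<longleftrightarrow> (\<forall>i\<in>{1..\<gamma>}. \<exists>k::nat. card (red C (p^i)) = p^k))
       \<and> (p_homogeneous p \<gamma> C \<longleftrightarrow> (\<exists>I::nat set. finite I \<and>
              real (card I) = log (real p) (real (card C)) \<and> (\<forall>l\<in>I. hat1C (p^l) = 0)))
       \<and> (p_homogeneous p \<gamma> C \<longleftrightarrow> (\<exists>I::nat set. finite I \<and>
              real (card I) \<ge> log (real p) (real (card C)) \<and> (\<forall>l\<in>I. hat1C (p^l) = 0)))
       \<and> (p_homogeneous p \<gamma> C \<longleftrightarrow> tiles p \<gamma> C)
       \<and> (p_homogeneous p \<gamma> C \<longleftrightarrow> spectral p \<gamma> C)"
proof -
  note C = assms(3,4)
  have p1: "p > 1" using assms(1) by (rule prime_gt_1_nat)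
  have fin: "finite C" using C finite_subset by blast
  let ?E = "{n. n < \<gamma> \<and> equidist p C n}"
  \<comment> \<open>The exponents of all zeros of \<open>hat1C\<close> at powers of
    \<open>p\<close>: the reflection of \<open>?E\<close>, hence of the same cardinality. It serves
    as \<open>I\<close> in one direction and contains every admissible \<open>I\<close> in the
    other.\<close>
  let ?Z = "{l. l < \<gamma> \<and> equidist p C (\<gamma> - 1 - l)}"
  have zero: "hat1C (p ^ l) = 0 \<longleftrightarrow> l \<in> ?Z" for l
    unfolding hat1C_def fourier_indicator_zero_iff[OF assms(1) C] by simp
  have hom_iff: "p_homogeneous p \<gamma> C \<longleftrightarrow> card C \<le> p ^ card ?E"
    by (rule p_homogeneous_iff_card_le[OF p1 C])
  have eq: "\<exists>I. finite I \<and> real (card I) = log (real p) (real (card C)) \<and> (\<forall>l\<in>I. hat1C (p^l) = 0)"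
    if "p_homogeneous p \<gamma> C"
  proof (intro exI conjI)
    have "real (card C) = real p ^ card ?E" using p_homogeneous_card[OF p1 C that] by simp
    thus "real (card ?Z) = log (real p) (real (card C))"
      using p1 by (simp only: card_reflect) (simp add: log_nat_power)
    show "\<forall>l\<in>?Z. hat1C (p^l) = 0" using zero by blast
  qed simp
  have ge: "p_homogeneous p \<gamma> C"
    if I: "finite I" "real (card I) \<ge> log (real p) (real (card C))" "\<forall>l\<in>I. hat1C (p^l) = 0" for I
  proof -
    have "I \<subseteq> ?Z" using I(3) zero by blast
    hence "card I \<le> card ?Z" by (intro card_mono) auto
    hence "card I \<le> card ?E" by (simp only: card_reflect)
    hence "log (real p) (real (card C)) \<le> real (card ?E)" using I(2) by linarith
    hence "real (card C) \<le> real p powr real (card ?E)"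
      using p1 fin C by (subst (asm) log_le_iff) (auto simp: card_gt_0_iff)
    also have "\<dots> = real (p ^ card ?E)" using p1 by (simp add: powr_realpow)
    finally show ?thesis unfolding hom_iff by (simp only: of_nat_le_iff)
  qed
  have "p_homogeneous p \<gamma> C \<longleftrightarrow> (\<exists>I. finite I \<and>
      real (card I) = log (real p) (real (card C)) \<and> (\<forall>l\<in>I. hat1C (p^l) = 0))"
    using eq ge by (metis order_refl)
  moreover have "p_homogeneous p \<gamma> C \<longleftrightarrow> (\<exists>I. finite I \<and>
      real (card I) \<ge> log (real p) (real (card C)) \<and> (\<forall>l\<in>I. hat1C (p^l) = 0))"
    using eq ge by (metis order_refl)
  moreover have "p_homogeneous p \<gamma> C \<longleftrightarrow> tiles p \<gamma> C"
    using p_homogeneous_imp_tiles[OF p1 C] tiles_imp_card_le[OF assms(1) C] hom_iff by blast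
  moreover have "p_homogeneous p \<gamma> C \<longleftrightarrow> spectral p \<gamma> C"
    using p_homogeneous_imp_spectral[OF assms(1) C] spectral_imp_card_le[OF assms(1) C] hom_iff by blast
  ultimately show ?thesis
    using p_homogeneous_iff_card_red[OF p1 fin C(2)] by blast
qed

end
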